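(* Let $\Phi$ and $\Psi$ be two perfect operator categories. Then the operator category $\Psi\wr\Phi$ is perfect as well.
   Context: An operator category $\Phi$ is an essentially small category with a terminal object $1$, with finite morphism sets, such that for every morphism $J\to I$ and every point $i\in|I|:=\mathrm{Mor}_\Phi(1,I)$ (also written $\{i\}\to I$) the fiber $J_i:=\{i\}\times_I J$ exists. A point classifier for $\Phi$ is a terminal object $(T,t)$ of the category whose objects are pairs $(I,i)$ with $i\in|I|$ and whose morphisms $(I,i)\to(J,j)$ are morphisms $f\colon I\to J$ with $f\circ i=j$ such that $\{i\}$ is the fiber of $f$ over $j$ (i.e. the evident square is a pullback). $\Phi$ is perfect if it has a point classifier $(T,t)$ and the functor $\mathrm{fib}\colon(\Phi/T)\to\Phi$, $(J\to T)\mapsto J_t$, admits a right adjoint. The wreath product $\Psi\wr\Phi$ is the category with objects $(I,M)$, where $I\in\Phi$ and $M=\{M_i\}_{i\in|I|}$ is a family of objects of $\Psi$; a morphism $(J,N)\to(I,M)$ is a morphism $\eta\colon J\to I$ of $\Phi$ together with morphisms $\omega_j\colon N_j\to M_{\eta(j)}$ of $\Psi$ for each $j\in|J|$. It is an operator category. *)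

theory Defs
  imports Main "HOL-Library.FuncSet"
begin

section \<open>Categories\<close>

text \<open>Objects and arrows form sets, so every category below is small; this is how essential
  smallness is rendered. Outside the carriers the operations are unconstrained.
  \<open>g \<cdot>\<^bsub>C\<^esub> f\<close> is \<open>g\<close> after \<open>f\<close>.\<close>

record ('o, 'm) cat =
  Obj :: "'o set"
  Arr :: "'m set"
  Dom :: "'m \<Rightarrow> 'o"
  Cod :: "'m \<Rightarrow> 'o"
  Id :: "'o \<Rightarrow> 'm"
  Comp :: "'m \<Rightarrow> 'm \<Rightarrow> 'm"  (infixr "\<cdot>\<index>" 70)

definition Hom :: "('o, 'm, 'x) cat_scheme \<Rightarrow> 'o \<Rightarrow> 'o \<Rightarrow> 'm set" where
  "Hom C a b = {f \<in> Arr C. Dom C f = a \<and> Cod C f = b}"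

locale category =
  fixes C :: "('o, 'm, 'x) cat_scheme" (structure)
  assumes Dom_Obj: "f \<in> Arr C \<Longrightarrow> Dom C f \<in> Obj C"
    and Cod_Obj: "f \<in> Arr C \<Longrightarrow> Cod C f \<in> Obj C"
    and Id_Hom: "a \<in> Obj C \<Longrightarrow> Id C a \<in> Hom C a a"
    and Comp_Hom: "f \<in> Hom C a b \<Longrightarrow> g \<in> Hom C b c \<Longrightarrow> g \<cdot> f \<in> Hom C a c"
    and Comp_Id: "f \<in> Hom C a b \<Longrightarrow> f \<cdot> Id C a = f"
    and Id_Comp: "f \<in> Hom C a b \<Longrightarrow> Id C b \<cdot> f = f"
    and Comp_assoc: "f \<in> Hom C a b \<Longrightarrow> g \<in> Hom C b c \<Longrightarrow> h \<in> Hom C c d \<Longrightarrow>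
          (h \<cdot> g) \<cdot> f = h \<cdot> (g \<cdot> f)"

definition is_terminal :: "('o, 'm, 'x) cat_scheme \<Rightarrow> 'o \<Rightarrow> bool" where
  "is_terminal C x \<longleftrightarrow> x \<in> Obj C \<and> (\<forall>a \<in> Obj C. \<exists>!f. f \<in> Hom C a x)"

text \<open>The square with \<open>f \<cdot> p = g \<cdot> q\<close> is a pullback.\<close>

definition is_pullback :: "('o, 'm, 'x) cat_scheme \<Rightarrow> 'm \<Rightarrow> 'm \<Rightarrow> 'm \<Rightarrow> 'm \<Rightarrow> bool" where
  "is_pullback C f g p q \<longleftrightarrow>
     f \<in> Arr C \<and> g \<in> Arr C \<and> Cod C f = Cod C g \<and>
     p \<in> Arr C \<and> q \<in> Arr C \<and> Dom C p = Dom C q \<and>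
     Cod C p = Dom C f \<and> Cod C q = Dom C g \<and> f \<cdot>\<^bsub>C\<^esub> p = g \<cdot>\<^bsub>C\<^esub> q \<and>
     (\<forall>a \<in> Obj C. \<forall>x \<in> Hom C a (Dom C f). \<forall>y \<in> Hom C a (Dom C g).
        f \<cdot>\<^bsub>C\<^esub> x = g \<cdot>\<^bsub>C\<^esub> y \<longrightarrow>
        (\<exists>!u. u \<in> Hom C a (Dom C p) \<and> p \<cdot>\<^bsub>C\<^esub> u = x \<and> q \<cdot>\<^bsub>C\<^esub> u = y))"

text \<open>The slice category \<open>C/T\<close>: a morphism from \<open>f\<close> to \<open>g\<close> is a triple \<open>(f, h, g)\<close>.\<close>

definition slice :: "('o, 'm, 'x) cat_scheme \<Rightarrow> 'o \<Rightarrow> ('m, 'm \<times> 'm \<times> 'm) cat" where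
  "slice C T = \<lparr>
     Obj = {f \<in> Arr C. Cod C f = T},
     Arr = {(f, h, g). f \<in> Arr C \<and> Cod C f = T \<and> g \<in> Arr C \<and> Cod C g = T \<and>
                       h \<in> Hom C (Dom C f) (Dom C g) \<and> g \<cdot>\<^bsub>C\<^esub> h = f},
     Dom = (\<lambda>(f, h, g). f),
     Cod = (\<lambda>(f, h, g). g),
     Id = (\<lambda>f. (f, Id C (Dom C f), f)),
     Comp = (\<lambda>(g', k, e) (f, h, g). (f, k \<cdot>\<^bsub>C\<^esub> h, e)) \<rparr>"


section \<open>Functors and adjunctions\<close>

locale cat_functor = A: category A + B: category B
  for A :: "('a, 'f, 'x) cat_scheme" and B :: "('b, 'g, 'y) cat_scheme" +
  fixes Fo :: "'a \<Rightarrow> 'b" and Fm :: "'f \<Rightarrow> 'g"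
  assumes Fo_Obj: "a \<in> Obj A \<Longrightarrow> Fo a \<in> Obj B"
    and Fm_Hom: "f \<in> Hom A a a' \<Longrightarrow> Fm f \<in> Hom B (Fo a) (Fo a')"
    and Fm_Id: "a \<in> Obj A \<Longrightarrow> Fm (Id A a) = Id B (Fo a)"
    and Fm_Comp: "f \<in> Hom A a a' \<Longrightarrow> f' \<in> Hom A a' a'' \<Longrightarrow>
          Fm (f' \<cdot>\<^bsub>A\<^esub> f) = Fm f' \<cdot>\<^bsub>B\<^esub> Fm f"

locale adjunction = F: cat_functor A B Fo Fm + G: cat_functor B A Go Gm
  for A :: "('a, 'f, 'x) cat_scheme" and B :: "('b, 'g, 'y) cat_scheme"
    and Fo :: "'a \<Rightarrow> 'b" and Fm :: "'f \<Rightarrow> 'g" and Go :: "'b \<Rightarrow> 'a" and Gm :: "'g \<Rightarrow> 'f" +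
  fixes \<phi> :: "'a \<Rightarrow> 'b \<Rightarrow> 'g \<Rightarrow> 'f"
  assumes bij: "a \<in> Obj A \<Longrightarrow> b \<in> Obj B \<Longrightarrow>
      bij_betw (\<phi> a b) (Hom B (Fo a) b) (Hom A a (Go b))"
    and natural: "f \<in> Hom A a' a \<Longrightarrow> g \<in> Hom B b b' \<Longrightarrow> h \<in> Hom B (Fo a) b \<Longrightarrow>
      \<phi> a' b' (g \<cdot>\<^bsub>B\<^esub> h \<cdot>\<^bsub>B\<^esub> Fm f) = Gm g \<cdot>\<^bsub>A\<^esub> \<phi> a b h \<cdot>\<^bsub>A\<^esub> f"

definition has_right_adjoint ::
  "('a, 'f, 'x) cat_scheme \<Rightarrow> ('b, 'g, 'y) cat_scheme \<Rightarrow> ('a \<Rightarrow> 'b) \<Rightarrow> ('f \<Rightarrow> 'g) \<Rightarrow> bool" where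
  "has_right_adjoint A B Fo Fm \<longleftrightarrow> (\<exists>Go Gm \<phi>. adjunction A B Fo Fm Go Gm \<phi>)"


section \<open>Operator categories\<close>

text \<open>The terminal object \<open>1\<close> entering the definition of points is part of the data.\<close>

record ('o, 'm) opcat = "('o, 'm) cat" +
  One :: 'o

definition Points :: "('o, 'm, 'x) opcat_scheme \<Rightarrow> 'o \<Rightarrow> 'm set" where
  "Points C I = Hom C (One C) I"

text \<open>A fiber of \<open>f : J \<rightarrow> I\<close> over a point \<open>i\<close> of \<open>I\<close> is given by its projection
  \<open>p : J\<^sub>i \<rightarrow> J\<close>; the fiber itself is \<open>Dom C p\<close>.\<close>

definition is_fiber :: "('o, 'm, 'x) opcat_scheme \<Rightarrow> 'm \<Rightarrow> 'm \<Rightarrow> 'm \<Rightarrow> bool" where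
  "is_fiber C f i p \<longleftrightarrow>
     i \<in> Points C (Cod C f) \<and> (\<exists>q \<in> Hom C (Dom C p) (One C). is_pullback C i f q p)"

locale operator_category = category C
  for C :: "('o, 'm, 'x) opcat_scheme" (structure) +
  assumes One_terminal: "is_terminal C (One C)"
    and finite_Hom: "I \<in> Obj C \<Longrightarrow> J \<in> Obj C \<Longrightarrow> finite (Hom C J I)"
    and fiber_exists: "f \<in> Hom C J I \<Longrightarrow> i \<in> Points C I \<Longrightarrow> \<exists>p. is_fiber C f i p"


section \<open>Point classifiers and perfection\<close>

text \<open>The category of pairs \<open>(I, i)\<close>; in the description of its arrows, \<open>is_fiber C f j i\<close>
  says that \<open>{i}\<close> is the fiber of \<open>f\<close> over \<open>j\<close>.\<close>

definition pointed :: "('o, 'm, 'x) opcat_scheme \<Rightarrow>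
    ('o \<times> 'm, ('o \<times> 'm) \<times> 'm \<times> ('o \<times> 'm)) cat" where
  "pointed C = \<lparr>
     Obj = {(I, i). I \<in> Obj C \<and> i \<in> Points C I},
     Arr = {((I, i), f, (J, j)). I \<in> Obj C \<and> i \<in> Points C I \<and> J \<in> Obj C \<and> j \<in> Points C J \<and>
              f \<in> Hom C I J \<and> f \<cdot>\<^bsub>C\<^esub> i = j \<and> is_fiber C f j i},
     Dom = (\<lambda>(x, f, y). x),
     Cod = (\<lambda>(x, f, y). y),
     Id = (\<lambda>(I, i). ((I, i), Id C I, (I, i))),
     Comp = (\<lambda>(y', g, z) (x, f, y). (x, g \<cdot>\<^bsub>C\<^esub> f, z)) \<rparr>"

definition point_classifier :: "('o, 'm, 'x) opcat_scheme \<Rightarrow> 'o \<Rightarrow> 'm \<Rightarrow> bool" where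
  "point_classifier C T t \<longleftrightarrow> is_terminal (pointed C) (T, t)"

text \<open>The functor \<open>fib : C/T \<rightarrow> C\<close> over a point \<open>t\<close> of \<open>T\<close>, for an arbitrary choice of fibers.
  Different choices give isomorphic functors.\<close>

definition fib_proj :: "('o, 'm, 'x) opcat_scheme \<Rightarrow> 'm \<Rightarrow> 'm \<Rightarrow> 'm" where
  "fib_proj C t f = (SOME p. is_fiber C f t p)"

definition fib_obj :: "('o, 'm, 'x) opcat_scheme \<Rightarrow> 'm \<Rightarrow> 'm \<Rightarrow> 'o" where
  "fib_obj C t f = Dom C (fib_proj C t f)"

definition fib_arr :: "('o, 'm, 'x) opcat_scheme \<Rightarrow> 'm \<Rightarrow> 'm \<times> 'm \<times> 'm \<Rightarrow> 'm" where
  "fib_arr C t = (\<lambda>(f, h, g). THE k. k \<in> Hom C (fib_obj C t f) (fib_obj C t g) \<and>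
                                     fib_proj C t g \<cdot>\<^bsub>C\<^esub> k = h \<cdot>\<^bsub>C\<^esub> fib_proj C t f)"

locale perfect_operator_category = operator_category C
  for C :: "('o, 'm, 'x) opcat_scheme" (structure) +
  assumes perfect: "\<exists>T t. point_classifier C T t \<and>
                          has_right_adjoint (slice C T) C (fib_obj C t) (fib_arr C t)"


section \<open>Wreath products\<close>

text \<open>Families indexed by points are extensional functions, so that equality of objects and
  of arrows is equality of families.\<close>

definition wreath_obj :: "('p, 'n) opcat \<Rightarrow> ('o, 'm) opcat \<Rightarrow> ('o \<times> ('m \<Rightarrow> 'p)) set" where
  "wreath_obj \<Psi> \<Phi> = {(I, M). I \<in> Obj \<Phi> \<and> M \<in> Points \<Phi> I \<rightarrow>\<^sub>E Obj \<Psi>}"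

definition wreath :: "('p, 'n) opcat \<Rightarrow> ('o, 'm) opcat \<Rightarrow>
    ('o \<times> ('m \<Rightarrow> 'p),
     ('o \<times> ('m \<Rightarrow> 'p)) \<times> ('m \<times> ('m \<Rightarrow> 'n)) \<times> ('o \<times> ('m \<Rightarrow> 'p))) opcat"  (infixr "\<wr>" 75) where
  "\<Psi> \<wr> \<Phi> = \<lparr>
     Obj = wreath_obj \<Psi> \<Phi>,
     Arr = {((J, N), (\<eta>, \<omega>), (I, M)). (J, N) \<in> wreath_obj \<Psi> \<Phi> \<and> (I, M) \<in> wreath_obj \<Psi> \<Phi> \<and>
              \<eta> \<in> Hom \<Phi> J I \<and> \<omega> \<in> (\<Pi>\<^sub>E j \<in> Points \<Phi> J. Hom \<Psi> (N j) (M (\<eta> \<cdot>\<^bsub>\<Phi>\<^esub> j)))},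
     Dom = (\<lambda>(x, f, y). x),
     Cod = (\<lambda>(x, f, y). y),
     Id = (\<lambda>(I, M). ((I, M), (Id \<Phi> I, \<lambda>i \<in> Points \<Phi> I. Id \<Psi> (M i)), (I, M))),
     Comp = (\<lambda>(y, (\<eta>', \<omega>'), z) ((J, N), (\<eta>, \<omega>), y').
               ((J, N), (\<eta>' \<cdot>\<^bsub>\<Phi>\<^esub> \<eta>, \<lambda>j \<in> Points \<Phi> J. \<omega>' (\<eta> \<cdot>\<^bsub>\<Phi>\<^esub> j) \<cdot>\<^bsub>\<Psi>\<^esub> \<omega> j), z)),
     One = (One \<Phi>, \<lambda>i \<in> Points \<Phi> (One \<Phi>). One \<Psi>) \<rparr>"

end

theory Submission
  imports Defs
begin

text \<open>A right adjoint of \<open>fib\<close> sends \<open>I\<close> to an object \<open>\<gamma> : D \<rightarrow> T\<close> over the point classifier with a map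
  \<open>e : D\<^sub>t \<rightarrow> I\<close> that classifies partial maps into \<open>I\<close> defined on fibers over \<open>t\<close>. Fibers in the wreath
  product are computed in \<open>\<Phi>\<close> and, over every point of the fiber, in \<open>\<Psi>\<close>. Hence, if \<open>(T, t)\<close> and
  \<open>(T', t')\<close> classify points of \<open>\<Phi>\<close> and \<open>\<Psi>\<close>, those of the wreath product are classified by \<open>T\<close> with the
  family that is \<open>T'\<close> at \<open>t\<close> and \<open>1\<close> elsewhere; and the right adjoint sends \<open>(I, M)\<close> to \<open>D\<close> with the family
  given at the points over \<open>t\<close>, which are the points of \<open>D\<^sub>t\<close>, by the right adjoint for \<open>\<Psi>\<close> at
  \<open>M\<^bsub>e(k)\<^esub>\<close>, and by \<open>1\<close> elsewhere.\<close>

section \<open>Categories and adjoints\<close>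

text \<open>The functor \<open>fib\<close> is built from fibers selected by \<open>SOME\<close>, and
  the fiber selected in \<Psi> \<wr> \<Phi> need not be the one assembled from fibers of \<Phi> and
  \<Psi>. The adjunction is therefore replaced by one couniversal arrow for each object, and this in
  turn by \<open>cofree_over\<close>, which quantifies over all fibers \<open>q\<close> of
  \<open>f\<close>. In that form the choice no longer matters, provided that arbitrary fibers of the
  wreath product can be taken apart; \<open>is_fiber_wreath_iff\<close> does this by comparing them
  with an assembled one. The value 1 away from the fibers is what lets the families be glued. At a
  point \<open>j\<close> of the source that is not sent to \<open>t\<close>, the family of the
  classifier and that of the right adjoint are both 1, so the component at \<open>j\<close> exists,
  is unique and satisfies every required equation. All remaining data sit at points over
  \<open>t\<close>, where the problem is one in \<Psi> for a single member of
  \<open>M\<close>.\<close>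

context category
begin

text \<open>The locale axioms carry the endpoints of arrows as extra variables. Stated through
  \<open>Dom\<close> and \<open>Cod\<close>, they become rewrite rules whose premises the simplifier
  can discharge.\<close>

lemma Comp_Arr [simp]:
  assumes "f \<in> Arr C" "g \<in> Arr C" "Cod C f = Dom C g"
  shows "g \<cdot> f \<in> Arr C" "Dom C (g \<cdot> f) = Dom C f" "Cod C (g \<cdot> f) = Cod C g"
  using Comp_Hom[of f "Dom C f" "Cod C f" g "Cod C g"] assms by (auto simp: Hom_def)

lemma Id_Arr [simp]:
  assumes "a \<in> Obj C"
  shows "Id C a \<in> Arr C" "Dom C (Id C a) = a" "Cod C (Id C a) = a"
  using Id_Hom[OF assms] by (auto simp: Hom_def)

lemma Comp_Id_Arr [simp]: "f \<in> Arr C \<Longrightarrow> Dom C f = a \<Longrightarrow> f \<cdot> Id C a = f"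
  using Comp_Id[of f a "Cod C f"] by (auto simp: Hom_def)

lemma Id_Comp_Arr [simp]: "f \<in> Arr C \<Longrightarrow> Cod C f = b \<Longrightarrow> Id C b \<cdot> f = f"
  using Id_Comp[of f "Dom C f" b] by (auto simp: Hom_def)

lemma Comp_assoc_Arr [simp]:
  assumes "f \<in> Arr C" "g \<in> Arr C" "h \<in> Arr C" "Cod C f = Dom C g" "Cod C g = Dom C h"
  shows "(h \<cdot> g) \<cdot> f = h \<cdot> g \<cdot> f"
  using Comp_assoc[of f "Dom C f" "Dom C g" g "Dom C h" h "Cod C h"] assms by (auto simp: Hom_def)

declare Dom_Obj [simp] Cod_Obj [simp]

lemma Hom_Obj: "f \<in> Hom C a b \<Longrightarrow> a \<in> Obj C \<and> b \<in> Obj C"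
  by (auto simp: Hom_def)

lemma Hom_slice:
  "x \<in> Hom (slice C T) f g \<longleftrightarrow> (\<exists>h. x = (f, h, g) \<and> f \<in> Arr C \<and> Cod C f = T \<and> g \<in> Arr C \<and>
     Cod C g = T \<and> h \<in> Hom C (Dom C f) (Dom C g) \<and> g \<cdot> h = f)"
  by (auto simp: slice_def Hom_def)

lemma category_slice: "category (slice C T)"
proof
  fix a assume "a \<in> Obj (slice C T)"
  then show "Id (slice C T) a \<in> Hom (slice C T) a a"
    by (simp add: Hom_slice Id_Hom) (simp add: slice_def Id_Hom)
next
  fix x a b y c assume "x \<in> Hom (slice C T) a b" "y \<in> Hom (slice C T) b c"
  then obtain h k where "x = (a, h, b)" "y = (b, k, c)" "h \<in> Hom C (Dom C a) (Dom C b)"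
      "k \<in> Hom C (Dom C b) (Dom C c)" "b \<cdot> h = a" "c \<cdot> k = b"
      "a \<in> Arr C" "b \<in> Arr C" "c \<in> Arr C" "Cod C a = T" "Cod C c = T"
    by (auto simp: Hom_slice)
  moreover from this have "c \<cdot> k \<cdot> h = a"
    using Comp_assoc[of h "Dom C a" "Dom C b" k "Dom C c" c "Cod C c"] by (simp add: Hom_def)
  ultimately show "y \<cdot>\<^bsub>slice C T\<^esub> x \<in> Hom (slice C T) a c"
    unfolding Hom_slice using Comp_Hom[of h _ _ k] by (simp add: slice_def)
qed (auto simp: Hom_slice Comp_Id Id_Comp Comp_assoc, auto simp: slice_def Comp_Id Id_Comp Comp_assoc)

end

text \<open>Says that \<open>(g, e)\<close> is terminal in the comma category of arrows from
  \<open>Fo\<close> to \<open>b\<close>. This describes a right adjoint one object at a time, with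
  no functor to be built.\<close>

definition couniversal :: "('a, 'f, 'x) cat_scheme \<Rightarrow> ('b, 'g, 'y) cat_scheme \<Rightarrow>
    ('a \<Rightarrow> 'b) \<Rightarrow> ('f \<Rightarrow> 'g) \<Rightarrow> 'b \<Rightarrow> 'a \<Rightarrow> 'g \<Rightarrow> bool" where
  "couniversal A B Fo Fm b g e \<longleftrightarrow> g \<in> Obj A \<and> e \<in> Hom B (Fo g) b \<and>
     (\<forall>a \<in> Obj A. \<forall>h \<in> Hom B (Fo a) b. \<exists>!k. k \<in> Hom A a g \<and> e \<cdot>\<^bsub>B\<^esub> Fm k = h)"

text \<open>The counit \<open>e\<close> is the preimage of the identity of \<open>Go b\<close> under
  \<phi>. Naturality along \<open>k\<close> shows that composing \<open>e\<close> with
  \<open>Fm k\<close> inverts \<phi>, and bijectivity of \<phi> gives the rest.\<close>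

lemma (in adjunction) couniversal_counit:
  assumes b: "b \<in> Obj B"
  shows "\<exists>e. couniversal A B Fo Fm b (Go b) e"
proof -
  have g: "Go b \<in> Obj A" using G.Fo_Obj[OF b] .
  have "Id A (Go b) \<in> \<phi> (Go b) b ` Hom B (Fo (Go b)) b"
    using bij[OF g b] F.A.Id_Hom[OF g] by (simp add: bij_betw_def)
  then obtain e where e: "e \<in> Hom B (Fo (Go b)) b" "\<phi> (Go b) b e = Id A (Go b)"
    by auto
  have \<phi>e: "\<phi> a b (e \<cdot>\<^bsub>B\<^esub> Fm k) = k" if k: "k \<in> Hom A a (Go b)" for a k
  proof -
    have "\<phi> a b (Id B b \<cdot>\<^bsub>B\<^esub> e \<cdot>\<^bsub>B\<^esub> Fm k) = Gm (Id B b) \<cdot>\<^bsub>A\<^esub> Id A (Go b) \<cdot>\<^bsub>A\<^esub> k"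
      using natural[OF k F.B.Id_Hom[OF b] e(1)] e(2) by simp
    also have "Id B b \<cdot>\<^bsub>B\<^esub> e \<cdot>\<^bsub>B\<^esub> Fm k = e \<cdot>\<^bsub>B\<^esub> Fm k"
      using F.B.Id_Comp[OF F.B.Comp_Hom[OF F.Fm_Hom[OF k] e(1)]] .
    also have "Gm (Id B b) \<cdot>\<^bsub>A\<^esub> Id A (Go b) \<cdot>\<^bsub>A\<^esub> k = k"
      using k g by (simp add: G.Fm_Id[OF b] Hom_def)
    finally show ?thesis .
  qed
  have univ: "\<exists>!k. k \<in> Hom A a (Go b) \<and> e \<cdot>\<^bsub>B\<^esub> Fm k = h"
    if a: "a \<in> Obj A" and h: "h \<in> Hom B (Fo a) b" for a h
  proof (intro ex1I conjI)
    show k: "\<phi> a b h \<in> Hom A a (Go b)"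
      using bij_betwE[OF bij[OF a b]] h by blast
    show "e \<cdot>\<^bsub>B\<^esub> Fm (\<phi> a b h) = h"
      using bij_betw_imp_inj_on[OF bij[OF a b]] h \<phi>e[OF k] F.B.Comp_Hom[OF F.Fm_Hom[OF k] e(1)]
      by (auto dest: inj_onD)
  qed (use \<phi>e in auto)
  show ?thesis
    unfolding couniversal_def by (intro exI[of _ e] conjI ballI g e(1) univ)
qed

context cat_functor
begin

text \<open>Functoriality of \<open>Gm\<close> and naturality of \<phi> are equations between arrows
  into some \<open>Go b\<close>; by uniqueness of factorizations it suffices to compare their images
  under \<open>Fm\<close> after \<open>e b\<close>.\<close>

lemma has_right_adjointI:
  assumes "\<And>b. b \<in> Obj B \<Longrightarrow> \<exists>g e. couniversal A B Fo Fm b g e"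
  shows "has_right_adjoint A B Fo Fm"
proof -
  obtain Go e where couni: "\<And>b. b \<in> Obj B \<Longrightarrow> couniversal A B Fo Fm b (Go b) (e b)"
    using assms by metis
  define \<phi> where "\<phi> a b h = (THE k. k \<in> Hom A a (Go b) \<and> e b \<cdot>\<^bsub>B\<^esub> Fm k = h)" for a b h
  \<comment> \<open>The only possible action on arrows: \<open>Gm g\<close> must make the counits at
    both ends of \<open>g\<close> commute with \<open>g\<close>.\<close>
  define Gm where "Gm g = \<phi> (Go (Dom B g)) (Cod B g) (g \<cdot>\<^bsub>B\<^esub> e (Dom B g))" for g
  have Go: "Go b \<in> Obj A" and e: "e b \<in> Hom B (Fo (Go b)) b" if "b \<in> Obj B" for b
    using couni[OF that] by (auto simp: couniversal_def)
  have \<phi>: "\<phi> a b h \<in> Hom A a (Go b) \<and> e b \<cdot>\<^bsub>B\<^esub> Fm (\<phi> a b h) = h"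
    if "a \<in> Obj A" "h \<in> Hom B (Fo a) b" for a b h
    unfolding \<phi>_def
    by (rule theI') (use couni[of b] that B.Hom_Obj in \<open>auto simp: couniversal_def\<close>)
  have \<phi>_eq: "\<phi> a b h = k"
    if "a \<in> Obj A" "b \<in> Obj B" "k \<in> Hom A a (Go b)" "e b \<cdot>\<^bsub>B\<^esub> Fm k = h" for a b h k
    unfolding \<phi>_def
  proof (rule the1_equality)
    have "h \<in> Hom B (Fo a) b"
      using B.Comp_Hom[OF Fm_Hom[OF that(3)] e[OF that(2)]] that(4) by simp
    then show "\<exists>!k. k \<in> Hom A a (Go b) \<and> e b \<cdot>\<^bsub>B\<^esub> Fm k = h"
      using couni[OF that(2)] that(1) by (auto simp: couniversal_def)
  qed (use that in auto)
  have Gm: "Gm g \<in> Hom A (Go b) (Go b') \<and> e b' \<cdot>\<^bsub>B\<^esub> Fm (Gm g) = g \<cdot>\<^bsub>B\<^esub> e b"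
    if g: "g \<in> Hom B b b'" for g b b'
    using \<phi>[of "Go b" "g \<cdot>\<^bsub>B\<^esub> e b" b'] Go[of b] B.Hom_Obj[OF g] B.Comp_Hom[OF e g] g
    by (auto simp: Gm_def Hom_def)
  have Gm_eq: "Gm g = k"
    if "g \<in> Hom B b b'" "k \<in> Hom A (Go b) (Go b')" "e b' \<cdot>\<^bsub>B\<^esub> Fm k = g \<cdot>\<^bsub>B\<^esub> e b" for g b b' k
    using \<phi>_eq[of "Go b" b' k] that Go[of b] B.Hom_Obj[OF that(1)]
    by (auto simp: Gm_def Hom_def)
  have step: "e b' \<cdot>\<^bsub>B\<^esub> Fm (Gm g \<cdot>\<^bsub>A\<^esub> k) = g \<cdot>\<^bsub>B\<^esub> e b \<cdot>\<^bsub>B\<^esub> Fm k"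
    if g: "g \<in> Hom B b b'" and k: "k \<in> Hom A a (Go b)" for g b b' k a
  proof -
    have "e b' \<cdot>\<^bsub>B\<^esub> Fm (Gm g \<cdot>\<^bsub>A\<^esub> k) = (e b' \<cdot>\<^bsub>B\<^esub> Fm (Gm g)) \<cdot>\<^bsub>B\<^esub> Fm k"
      using Fm_Comp[OF k, of "Gm g" "Go b'"] Gm[OF g] B.Hom_Obj[OF g]
        B.Comp_assoc[OF Fm_Hom[OF k] Fm_Hom[of "Gm g" "Go b" "Go b'"] e[of b']] by simp
    also have "\<dots> = g \<cdot>\<^bsub>B\<^esub> e b \<cdot>\<^bsub>B\<^esub> Fm k"
      using Gm[OF g] B.Hom_Obj[OF g] B.Comp_assoc[OF Fm_Hom[OF k] e[of b] g] by simp
    finally show ?thesis .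
  qed
  have "adjunction A B Fo Fm Go Gm \<phi>"
  proof (unfold_locales)
    fix b assume b: "b \<in> Obj B"
    show "Go b \<in> Obj A" using Go[OF b] .
    show "Gm (Id B b) = Id A (Go b)"
      by (rule Gm_eq[OF B.Id_Hom[OF b] A.Id_Hom[OF Go[OF b]]])
        (use e[OF b] Go[OF b] b in \<open>simp add: Fm_Id Hom_def Fo_Obj\<close>)
  next
    fix f a a' assume "f \<in> Hom B a a'"
    then show "Gm f \<in> Hom A (Go a) (Go a')" using Gm by blast
  next
    fix f a a' f' a'' assume f: "f \<in> Hom B a a'" and f': "f' \<in> Hom B a' a''"
    have "e a'' \<cdot>\<^bsub>B\<^esub> Fm (Gm f' \<cdot>\<^bsub>A\<^esub> Gm f) = (f' \<cdot>\<^bsub>B\<^esub> f) \<cdot>\<^bsub>B\<^esub> e a"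
      using step[OF f'] Gm[OF f] e[of a] f f' by (auto simp: Hom_def)
    then show "Gm (f' \<cdot>\<^bsub>B\<^esub> f) = Gm f' \<cdot>\<^bsub>A\<^esub> Gm f"
      using Gm_eq[OF B.Comp_Hom[OF f f']] A.Comp_Hom Gm f f' by blast
  next
    fix a b assume a: "a \<in> Obj A" and b: "b \<in> Obj B"
    show "bij_betw (\<phi> a b) (Hom B (Fo a) b) (Hom A a (Go b))"
      by (rule bij_betw_byWitness[where f' = "\<lambda>k. e b \<cdot>\<^bsub>B\<^esub> Fm k"])
        (use \<phi> \<phi>_eq a b B.Comp_Hom[OF Fm_Hom e] in auto)
  next
    fix f a' a g b b' h
    assume f: "f \<in> Hom A a' a" and g: "g \<in> Hom B b b'" and h: "h \<in> Hom B (Fo a) b"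
    have obj: "a \<in> Obj A" "a' \<in> Obj A" "b \<in> Obj B" "b' \<in> Obj B"
      using A.Hom_Obj[OF f] B.Hom_Obj[OF g] by auto
    note k = \<phi>[OF obj(1) h]
    have kf: "\<phi> a b h \<cdot>\<^bsub>A\<^esub> f \<in> Hom A a' (Go b)"
      using A.Comp_Hom[OF f] k by blast
    have "e b \<cdot>\<^bsub>B\<^esub> Fm (\<phi> a b h \<cdot>\<^bsub>A\<^esub> f) = h \<cdot>\<^bsub>B\<^esub> Fm f"
      using Fm_Comp[OF f, of "\<phi> a b h" "Go b"] k
        B.Comp_assoc[OF Fm_Hom[OF f] Fm_Hom[of "\<phi> a b h" a "Go b"] e[OF obj(3)]] by simp
    then show "\<phi> a' b' (g \<cdot>\<^bsub>B\<^esub> h \<cdot>\<^bsub>B\<^esub> Fm f) = Gm g \<cdot>\<^bsub>A\<^esub> \<phi> a b h \<cdot>\<^bsub>A\<^esub> f"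
      using \<phi>_eq[OF obj(2,4)] A.Comp_Hom[OF kf] Gm[OF g] step[OF g kf] by auto
  qed
  then show ?thesis by (auto simp: has_right_adjoint_def)
qed

end

lemma has_right_adjointD:
  "has_right_adjoint A B Fo Fm \<Longrightarrow> b \<in> Obj B \<Longrightarrow> \<exists>g e. couniversal A B Fo Fm b g e"
  unfolding has_right_adjoint_def by (elim exE) (rule exI, rule adjunction.couniversal_counit)


section \<open>Fibers\<close>

definition bang :: "('o, 'm, 'x) opcat_scheme \<Rightarrow> 'o \<Rightarrow> 'm" where
  "bang C a = (THE f. f \<in> Hom C a (One C))"

text \<open>Kept apart from \<open>operator_category\<close> because the facts on fibers below are
  applied to the wreath product before its fibers are known to exist.\<close>

locale category_with_One = category C for C :: "('o, 'm, 'x) opcat_scheme" (structure) +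
  assumes terminal_One: "is_terminal C (One C)"
begin

lemma One_Obj [simp]: "One C \<in> Obj C"
  using terminal_One by (simp add: is_terminal_def)

lemma bang_Hom: "a \<in> Obj C \<Longrightarrow> bang C a \<in> Hom C a (One C)"
  unfolding bang_def by (rule theI') (use terminal_One in \<open>simp add: is_terminal_def\<close>)

lemma bang_Arr [simp]:
  assumes "a \<in> Obj C"
  shows "bang C a \<in> Arr C" "Dom C (bang C a) = a" "Cod C (bang C a) = One C"
  using bang_Hom[OF assms] by (auto simp: Hom_def)

lemma bang_unique: "f \<in> Arr C \<Longrightarrow> Dom C f = a \<Longrightarrow> Cod C f = One C \<Longrightarrow> f = bang C a"
  using terminal_One bang_Hom[of a] Dom_Obj[of f] unfolding is_terminal_def Hom_def by blast

lemma bang_One [simp]: "bang C (One C) = Id C (One C)"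
  by (rule bang_unique[symmetric]) auto

lemma bang_Comp [simp]: "f \<in> Arr C \<Longrightarrow> Cod C f = a \<Longrightarrow> bang C a \<cdot> f = bang C (Dom C f)"
  by (rule bang_unique) auto

lemma Points_One [simp]: "Points C (One C) = {Id C (One C)}"
  using bang_unique[of _ "One C"] by (auto simp: Points_def Hom_def)

lemma Points_iff: "x \<in> Points C I \<longleftrightarrow> x \<in> Arr C \<and> Dom C x = One C \<and> Cod C x = I"
  by (auto simp: Points_def Hom_def)

text \<open>The other projection and the other leg of every test cone end in the terminal object,
  hence are determined; the pullback becomes a condition on \<open>p\<close> alone.\<close>

lemma is_fiber_iff:
  "is_fiber C f i p \<longleftrightarrow> f \<in> Arr C \<and> p \<in> Arr C \<and> Cod C p = Dom C f \<and> i \<in> Points C (Cod C f) \<and>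
     f \<cdot> p = i \<cdot> bang C (Dom C p) \<and>
     (\<forall>y \<in> Arr C. Cod C y = Dom C f \<longrightarrow> f \<cdot> y = i \<cdot> bang C (Dom C y) \<longrightarrow>
        (\<exists>!u. u \<in> Hom C (Dom C y) (Dom C p) \<and> p \<cdot> u = y))"
  (is "?L \<longleftrightarrow> ?R")
proof
  assume ?L
  then obtain q where i: "i \<in> Points C (Cod C f)" and q: "q \<in> Hom C (Dom C p) (One C)"
    and pb: "is_pullback C i f q p"
    by (auto simp: is_fiber_def)
  have arr: "f \<in> Arr C" "p \<in> Arr C" "Cod C p = Dom C f" and comm: "i \<cdot> q = f \<cdot> p"
    using pb by (simp_all add: is_pullback_def)
  have Domi: "Dom C i = One C" using i by (simp add: Points_iff)
  have qb: "q = bang C (Dom C p)" using q by (auto simp: Hom_def intro: bang_unique)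
  have univ: "\<forall>a \<in> Obj C. \<forall>x \<in> Hom C a (Dom C i). \<forall>y \<in> Hom C a (Dom C f). i \<cdot> x = f \<cdot> y \<longrightarrow>
      (\<exists>!u. u \<in> Hom C a (Dom C p) \<and> q \<cdot> u = x \<and> p \<cdot> u = y)"
    using pb q unfolding is_pullback_def by (elim conjE) (simp add: Hom_def)
  have "\<exists>!u. u \<in> Hom C (Dom C y) (Dom C p) \<and> p \<cdot> u = y"
    if y: "y \<in> Arr C" "Cod C y = Dom C f" "f \<cdot> y = i \<cdot> bang C (Dom C y)" for y
  proof -
    have "\<exists>!u. u \<in> Hom C (Dom C y) (Dom C p) \<and> q \<cdot> u = bang C (Dom C y) \<and> p \<cdot> u = y"
      using univ y Domi bang_Hom[of "Dom C y"] by (auto simp: Hom_def)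
    moreover have "q \<cdot> u = bang C (Dom C y)" if "u \<in> Hom C (Dom C y) (Dom C p)" for u
      using that by (simp add: qb Hom_def)
    ultimately show ?thesis by metis
  qed
  then show ?R using arr comm i qb by simp
next
  assume R: ?R
  then have arr: "f \<in> Arr C" "p \<in> Arr C" "Cod C p = Dom C f" "i \<in> Points C (Cod C f)"
      "f \<cdot> p = i \<cdot> bang C (Dom C p)"
    by simp_all
  then have iD: "i \<in> Arr C" "Dom C i = One C" "Cod C i = Cod C f" by (simp_all add: Points_iff)
  have univ: "\<exists>!u. u \<in> Hom C (Dom C y) (Dom C p) \<and> p \<cdot> u = y"
    if "y \<in> Arr C" "Cod C y = Dom C f" "i \<cdot> bang C (Dom C y) = f \<cdot> y" for y
    using R that by metis
  have "is_pullback C i f (bang C (Dom C p)) p"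
    unfolding is_pullback_def
  proof (intro conjI ballI impI)
    fix a x y
    assume a: "a \<in> Obj C" and x: "x \<in> Hom C a (Dom C i)" and y: "y \<in> Hom C a (Dom C f)"
      and eq: "i \<cdot> x = f \<cdot> y"
    have xb: "x = bang C a" using x iD by (auto intro: bang_unique simp: Hom_def)
    have "y \<in> Arr C" "Cod C y = Dom C f" and Domy: "Dom C y = a" using y by (auto simp: Hom_def)
    then have "\<exists>!u. u \<in> Hom C (Dom C y) (Dom C p) \<and> p \<cdot> u = y"
      using eq xb by (intro univ) simp_all
    then have "\<exists>!u. u \<in> Hom C a (Dom C p) \<and> p \<cdot> u = y"
      using Domy by simp
    moreover have "bang C (Dom C p) \<cdot> u = x" if "u \<in> Hom C a (Dom C p)" for u
      using that xb by (simp add: Hom_def)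
    ultimately show "\<exists>!u. u \<in> Hom C a (Dom C (bang C (Dom C p))) \<and>
        bang C (Dom C p) \<cdot> u = x \<and> p \<cdot> u = y"
      using arr by (simp, metis)
  qed (use arr iD in auto)
  then show ?L using arr bang_Hom[of "Dom C p"] by (auto simp: is_fiber_def)
qed

lemma is_fiberD:
  assumes "is_fiber C f i p"
  shows "f \<in> Arr C" "p \<in> Arr C" "Cod C p = Dom C f" "i \<in> Points C (Cod C f)"
    "f \<cdot> p = i \<cdot> bang C (Dom C p)"
  using assms by (auto simp: is_fiber_iff)

lemma fiber_lift_unique:
  assumes "is_fiber C f i p" "y \<in> Arr C" "Cod C y = Dom C f" "f \<cdot> y = i \<cdot> bang C (Dom C y)"
  shows "\<exists>!u. u \<in> Hom C (Dom C y) (Dom C p) \<and> p \<cdot> u = y"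
  using assms by (simp add: is_fiber_iff)

lemma fiber_lift:
  assumes "is_fiber C f i p" "y \<in> Arr C" "Cod C y = Dom C f" "f \<cdot> y = i \<cdot> bang C (Dom C y)"
  obtains u where "u \<in> Arr C" "Dom C u = Dom C y" "Cod C u = Dom C p" "p \<cdot> u = y"
  using fiber_lift_unique[OF assms] by (auto simp: Hom_def)

text \<open>Both arrows are lifts of \<open>p \<cdot> u\<close>, which lies over \<open>i\<close>,
  so uniqueness of lifts applies.\<close>

lemma fiber_mono:
  assumes p: "is_fiber C f i p" and u: "u \<in> Hom C a (Dom C p)" "v \<in> Hom C a (Dom C p)"
    and eq: "p \<cdot> u = p \<cdot> v"
  shows "u = v"
proof -
  note D = is_fiberD[OF p]
  have "f \<cdot> p \<cdot> u = (f \<cdot> p) \<cdot> u" using u D(1-3) by (simp add: Hom_def)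
  also have "\<dots> = i \<cdot> bang C (Dom C (p \<cdot> u))" using u D by (simp add: Hom_def Points_iff)
  finally have "\<exists>!w. w \<in> Hom C (Dom C (p \<cdot> u)) (Dom C p) \<and> p \<cdot> w = p \<cdot> u"
    using u D by (intro fiber_lift_unique[OF p]) (simp_all add: Hom_def)
  moreover have "Dom C (p \<cdot> u) = a" using u D by (simp add: Hom_def)
  ultimately show ?thesis using u eq by metis
qed

lemma fiber_point:
  assumes "is_fiber C f i p" "k \<in> Points C (Dom C p)"
  shows "p \<cdot> k \<in> Points C (Dom C f)" "f \<cdot> p \<cdot> k = i"
proof -
  note D = is_fiberD[OF assms(1)]
  show "p \<cdot> k \<in> Points C (Dom C f)" using D assms(2) by (simp add: Points_iff)
  have "f \<cdot> p \<cdot> k = (f \<cdot> p) \<cdot> k" using assms(2) D(1-3) by (simp add: Points_iff)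
  also have "\<dots> = i" using D(2,4,5) assms(2) by (simp add: Points_iff)
  finally show "f \<cdot> p \<cdot> k = i" .
qed

text \<open>The universal property tested on arrows out of \<open>One C\<close>. With
  \<open>fiber_point\<close> it identifies the points of the fiber with the points over
  \<open>i\<close>, which lets families on one be moved to the other.\<close>

lemma fiber_point_lift:
  assumes "is_fiber C f i p" "j \<in> Points C (Dom C f)" "f \<cdot> j = i"
  shows "\<exists>!k. k \<in> Points C (Dom C p) \<and> p \<cdot> k = j"
proof -
  note D = is_fiberD[OF assms(1)]
  have "f \<cdot> j = i \<cdot> bang C (Dom C j)" using assms D by (simp add: Points_iff)
  then show ?thesis
    using fiber_lift_unique[OF assms(1), of j] assms(2) by (simp add: Points_def Hom_def)
qed

text \<open>A lift through \<open>p\<close> followed by \<open>v'\<close> is a lift through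
  \<open>p \<cdot> v\<close>. This carries the fiber property from a constructed fiber to an
  arbitrary one.\<close>

lemma fiber_Comp_iso:
  assumes p: "is_fiber C f i p" and v: "v \<in> Hom C K (Dom C p)" "v' \<in> Hom C (Dom C p) K"
    and inv: "v \<cdot> v' = Id C (Dom C p)" "v' \<cdot> v = Id C K"
  shows "is_fiber C f i (p \<cdot> v)"
proof -
  note D = is_fiberD[OF p]
  have V: "v \<in> Arr C" "Dom C v = K" "Cod C v = Dom C p" "v' \<in> Arr C" "Dom C v' = Dom C p"
      "Cod C v' = K"
    using v by (auto simp: Hom_def)
  have "f \<cdot> p \<cdot> v = (f \<cdot> p) \<cdot> v" using V D(1-3) by simp
  also have "\<dots> = i \<cdot> bang C K" using V D(2,4,5) by (simp add: Points_iff)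
  finally have 1: "f \<cdot> p \<cdot> v = i \<cdot> bang C K" .
  have 2: "\<exists>!u. u \<in> Hom C (Dom C y) K \<and> (p \<cdot> v) \<cdot> u = y"
    if y: "y \<in> Arr C" "Cod C y = Dom C f" "f \<cdot> y = i \<cdot> bang C (Dom C y)" for y
  proof -
    obtain w where w: "w \<in> Arr C" "Dom C w = Dom C y" "Cod C w = Dom C p" "p \<cdot> w = y"
      using fiber_lift[OF p y] .
    show ?thesis
    proof (intro ex1I conjI)
      show "v' \<cdot> w \<in> Hom C (Dom C y) K" using w V by (simp add: Hom_def)
      have "v \<cdot> v' \<cdot> w = (v \<cdot> v') \<cdot> w" using w V by simp
      then show "(p \<cdot> v) \<cdot> v' \<cdot> w = y" using w V D(2) inv(1) by simp
    next
      fix u assume "u \<in> Hom C (Dom C y) K \<and> (p \<cdot> v) \<cdot> u = y"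
      then have u: "u \<in> Hom C (Dom C y) K" "(p \<cdot> v) \<cdot> u = y" by simp_all
      have "p \<cdot> v \<cdot> u = (p \<cdot> v) \<cdot> u" using u(1) V D(2) by (simp add: Hom_def)
      also have "\<dots> = p \<cdot> w" using u(2) w by simp
      finally have "p \<cdot> v \<cdot> u = p \<cdot> w" .
      then have "v \<cdot> u = w"
        by (rule fiber_mono[OF p, of _ "Dom C y", rotated 2])
          (use u(1) V w(1-3) in \<open>simp_all add: Hom_def\<close>)
      then have "v' \<cdot> w = (v' \<cdot> v) \<cdot> u" using u(1) V by (auto simp: Hom_def)
      then show "u = v' \<cdot> w" using inv(2) u(1) by (simp add: Hom_def)
    qed
  qed
  show ?thesis unfolding is_fiber_iff using D V 1 2 by simp
qed

text \<open>Each projection lifts through the other, and the composites are identities because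
  projections are monic.\<close>

lemma fibers_iso:
  assumes p: "is_fiber C f i p" and q: "is_fiber C f i q"
  obtains v v' where "v \<in> Hom C (Dom C q) (Dom C p)" "v' \<in> Hom C (Dom C p) (Dom C q)"
    "q = p \<cdot> v" "p = q \<cdot> v'" "v \<cdot> v' = Id C (Dom C p)" "v' \<cdot> v = Id C (Dom C q)"
proof -
  note P = is_fiberD[OF p] and Q = is_fiberD[OF q]
  obtain v where v: "v \<in> Arr C" "Dom C v = Dom C q" "Cod C v = Dom C p" "p \<cdot> v = q"
    using fiber_lift[OF p] Q by metis
  obtain v' where v': "v' \<in> Arr C" "Dom C v' = Dom C p" "Cod C v' = Dom C q" "q \<cdot> v' = p"
    using fiber_lift[OF q] P by metis
  have "p \<cdot> v \<cdot> v' = (p \<cdot> v) \<cdot> v'" "q \<cdot> v' \<cdot> v = (q \<cdot> v') \<cdot> v"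
    using v(1-3) v'(1-3) P Q by simp_all
  then have "p \<cdot> v \<cdot> v' = p \<cdot> Id C (Dom C p)" "q \<cdot> v' \<cdot> v = q \<cdot> Id C (Dom C q)"
    using v v' P Q by simp_all
  then have "v \<cdot> v' = Id C (Dom C p)" "v' \<cdot> v = Id C (Dom C q)"
    using fiber_mono[OF p, of "v \<cdot> v'" "Dom C p" "Id C (Dom C p)"]
      fiber_mono[OF q, of "v' \<cdot> v" "Dom C q" "Id C (Dom C q)"] v(1-3) v'(1-3) P Q
    by (simp_all add: Hom_def)
  with v v' show ?thesis by (intro that) (auto simp: Hom_def)
qed

end

sublocale operator_category \<subseteq> category_with_One
  by unfold_locales (rule One_terminal)


section \<open>Perfection\<close>

context operator_category
begin

lemma is_fiber_fib_proj:
  assumes "f \<in> Arr C" "t \<in> Points C (Cod C f)"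
  shows "is_fiber C f t (fib_proj C t f)"
  unfolding fib_proj_def using fiber_exists[of f "Dom C f" "Cod C f"] assms
  by (auto intro: someI_ex simp: Hom_def)

text \<open>The description defining \<open>fib_arr\<close> is proper: since
  \<open>g \<cdot> h = f\<close>, the arrow \<open>h\<close> after the projection of
  \<open>f\<close> lies over \<open>t\<close> and lifts uniquely to the fiber of
  \<open>g\<close>.\<close>

lemma fib_arr:
  assumes "f \<in> Arr C" "g \<in> Arr C" "Cod C f = Cod C g" "t \<in> Points C (Cod C g)"
    and h: "h \<in> Hom C (Dom C f) (Dom C g)" "g \<cdot> h = f"
  shows "fib_arr C t (f, h, g) \<in> Hom C (fib_obj C t f) (fib_obj C t g)"
    and "fib_proj C t g \<cdot> fib_arr C t (f, h, g) = h \<cdot> fib_proj C t f"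
    and "\<And>k. k \<in> Hom C (fib_obj C t f) (fib_obj C t g) \<Longrightarrow>
          fib_proj C t g \<cdot> k = h \<cdot> fib_proj C t f \<Longrightarrow> fib_arr C t (f, h, g) = k"
proof -
  have p: "is_fiber C f t (fib_proj C t f)" and q: "is_fiber C g t (fib_proj C t g)"
    using is_fiber_fib_proj assms by auto
  have eq: "g \<cdot> h \<cdot> fib_proj C t f = t \<cdot> bang C (fib_obj C t f)"
    using is_fiberD[OF p] assms(1,2) Comp_assoc_Arr[of "fib_proj C t f" h g] h
    by (simp add: Hom_def fib_obj_def)
  have ex1: "\<exists>!k. k \<in> Hom C (fib_obj C t f) (fib_obj C t g) \<and>
        fib_proj C t g \<cdot> k = h \<cdot> fib_proj C t f"
    using fiber_lift_unique[OF q, of "h \<cdot> fib_proj C t f"] eq is_fiberD[OF p] h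
    by (simp add: Hom_def fib_obj_def)
  show "fib_arr C t (f, h, g) \<in> Hom C (fib_obj C t f) (fib_obj C t g)"
    "fib_proj C t g \<cdot> fib_arr C t (f, h, g) = h \<cdot> fib_proj C t f"
    using theI'[OF ex1] by (auto simp: fib_arr_def)
  show "fib_arr C t (f, h, g) = k" if "k \<in> Hom C (fib_obj C t f) (fib_obj C t g)"
    "fib_proj C t g \<cdot> k = h \<cdot> fib_proj C t f" for k
    using the1_equality[OF ex1] that by (auto simp: fib_arr_def)
qed

text \<open>Both functor laws come from uniqueness of the lift: the candidate arrows agree after the
  chosen projection.\<close>

lemma fib_functor:
  assumes t: "t \<in> Points C T"
  shows "cat_functor (slice C T) C (fib_obj C t) (fib_arr C t)"
proof -
  have Obj: "f \<in> Obj (slice C T) \<longleftrightarrow> f \<in> Arr C \<and> Cod C f = T" for f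
    by (simp add: slice_def)
  have proj: "fib_proj C t f \<in> Hom C (fib_obj C t f) (Dom C f)" if "f \<in> Arr C" "Cod C f = T" for f
    using is_fiberD[OF is_fiber_fib_proj[of f t]] that t by (simp add: Hom_def fib_obj_def)
  interpret S: category "slice C T" by (rule category_slice)
  show ?thesis
  proof unfold_locales
    fix f assume f: "f \<in> Obj (slice C T)"
    show "fib_obj C t f \<in> Obj C"
      using f proj[THEN Hom_Obj] by (auto simp: Obj)
    then show "fib_arr C t (Id (slice C T) f) = Id C (fib_obj C t f)"
      using f proj[of f] t fib_arr(3)[of f f t "Id C (Dom C f)" "Id C (fib_obj C t f)"]
      by (auto simp: slice_def Hom_def)
  next
    fix x f g assume "x \<in> Hom (slice C T) f g"
    then show "fib_arr C t x \<in> Hom C (fib_obj C t f) (fib_obj C t g)"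
      using t by (auto simp: Hom_slice intro: fib_arr)
  next
    fix x f g y k assume x: "x \<in> Hom (slice C T) f g" and y: "y \<in> Hom (slice C T) g k"
    then obtain a b where a: "x = (f, a, g)" "a \<in> Hom C (Dom C f) (Dom C g)" "g \<cdot> a = f"
      and b: "y = (g, b, k)" "b \<in> Hom C (Dom C g) (Dom C k)" "k \<cdot> b = g"
      and arr: "f \<in> Arr C" "g \<in> Arr C" "k \<in> Arr C" "Cod C f = T" "Cod C g = T" "Cod C k = T"
      by (auto simp: Hom_slice)
    have comp: "y \<cdot>\<^bsub>slice C T\<^esub> x = (f, b \<cdot> a, k)" by (simp add: slice_def a b)
    have k: "k \<in> Hom C (Dom C k) T" using arr by (simp add: Hom_def)
    have ba: "b \<cdot> a \<in> Hom C (Dom C f) (Dom C k)" "k \<cdot> b \<cdot> a = f"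
      using Comp_Hom[OF a(2) b(2)] Comp_assoc[OF a(2) b(2) k, symmetric] by (simp_all only: a(3) b(3))
    note A = fib_arr(1,2)[of f g t a] and B = fib_arr(1,2)[of g k t b]
    have AB: "fib_arr C t x \<in> Hom C (fib_obj C t f) (fib_obj C t g)"
      "fib_arr C t y \<in> Hom C (fib_obj C t g) (fib_obj C t k)"
      "fib_proj C t g \<cdot> fib_arr C t x = a \<cdot> fib_proj C t f"
      "fib_proj C t k \<cdot> fib_arr C t y = b \<cdot> fib_proj C t g"
      using A B a b arr t by simp_all
    have "fib_proj C t k \<cdot> fib_arr C t y \<cdot> fib_arr C t x = (fib_proj C t k \<cdot> fib_arr C t y) \<cdot> fib_arr C t x"
      using AB(1,2) proj[of k] arr by (simp add: Hom_def)
    also have "\<dots> = b \<cdot> fib_proj C t g \<cdot> fib_arr C t x"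
      unfolding AB(4) using AB(1) proj[of g] arr b by (simp add: Hom_def)
    also have "\<dots> = (b \<cdot> a) \<cdot> fib_proj C t f"
      using AB(3) proj[of f] arr a b by (simp add: Hom_def)
    finally show "fib_arr C t (y \<cdot>\<^bsub>slice C T\<^esub> x) = fib_arr C t y \<cdot> fib_arr C t x"
      unfolding comp using ba arr t AB Comp_Hom[OF AB(1,2)] by (intro fib_arr(3)) auto
  qed
qed

end

text \<open>Couniversal arrows for \<open>fib\<close> without a choice of fibers: a map \<open>h\<close> into \<open>I\<close> that is defined on
  the fiber of some \<open>f\<close> over \<open>t\<close> is the restriction of a unique map over \<open>T\<close> to \<open>\<gamma>\<close>.\<close>

definition cofree_over :: "('o, 'm, 'x) opcat_scheme \<Rightarrow> 'o \<Rightarrow> 'm \<Rightarrow> 'o \<Rightarrow> 'm \<Rightarrow> 'm \<Rightarrow> 'm \<Rightarrow> bool" where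
  "cofree_over C T t I \<gamma> p e \<longleftrightarrow>
     \<gamma> \<in> Arr C \<and> Cod C \<gamma> = T \<and> is_fiber C \<gamma> t p \<and> e \<in> Hom C (Dom C p) I \<and>
     (\<forall>f q h. f \<in> Arr C \<longrightarrow> Cod C f = T \<longrightarrow> is_fiber C f t q \<longrightarrow> h \<in> Hom C (Dom C q) I \<longrightarrow>
        (\<exists>!k. k \<in> Hom C (Dom C f) (Dom C \<gamma>) \<and> \<gamma> \<cdot>\<^bsub>C\<^esub> k = f \<and>
           (\<exists>u \<in> Hom C (Dom C q) (Dom C p). p \<cdot>\<^bsub>C\<^esub> u = k \<cdot>\<^bsub>C\<^esub> q \<and> e \<cdot>\<^bsub>C\<^esub> u = h)))"

context operator_category
begin

text \<open>The chosen fiber of \<gamma> maps to the given one by a comparison arrow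
  \<open>v\<close>, and \<open>e \<cdot> v\<close> is the counit component.\<close>

lemma couniversal_of_cofree_over:
  assumes t: "t \<in> Points C T" and cof: "cofree_over C T t I \<gamma> p e"
  shows "\<exists>e'. couniversal (slice C T) C (fib_obj C t) (fib_arr C t) I \<gamma> e'"
proof -
  have \<gamma>: "\<gamma> \<in> Arr C" "Cod C \<gamma> = T" and p: "is_fiber C \<gamma> t p" and e: "e \<in> Hom C (Dom C p) I"
    and univ: "\<And>f q h. f \<in> Arr C \<Longrightarrow> Cod C f = T \<Longrightarrow> is_fiber C f t q \<Longrightarrow> h \<in> Hom C (Dom C q) I \<Longrightarrow>
        \<exists>!k. k \<in> Hom C (Dom C f) (Dom C \<gamma>) \<and> \<gamma> \<cdot> k = f \<and>
           (\<exists>u \<in> Hom C (Dom C q) (Dom C p). p \<cdot> u = k \<cdot> q \<and> e \<cdot> u = h)"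
    using cof by (auto simp: cofree_over_def)
  have fp: "is_fiber C f t (fib_proj C t f)" if "f \<in> Arr C" "Cod C f = T" for f
    using is_fiber_fib_proj that t by simp
  note P = is_fiberD[OF p] and Q = is_fiberD[OF fp[OF \<gamma>]]
  obtain v where v: "v \<in> Arr C" "Dom C v = fib_obj C t \<gamma>" "Cod C v = Dom C p"
      "p \<cdot> v = fib_proj C t \<gamma>"
    using fiber_lift[OF p] Q unfolding fib_obj_def by metis
  have "\<exists>!x. x \<in> Hom (slice C T) f \<gamma> \<and> (e \<cdot> v) \<cdot> fib_arr C t x = h"
    if f: "f \<in> Arr C" "Cod C f = T" and h: "h \<in> Hom C (fib_obj C t f) I" for f h
  proof -
    \<comment> \<open>The witness \<open>u\<close> has no freedom: as \<open>p\<close> is monic, it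
      can only be \<open>v\<close> after the value of \<open>fib\<close> on
      \<open>k\<close>.\<close>
    have equiv: "(\<exists>u \<in> Hom C (fib_obj C t f) (Dom C p). p \<cdot> u = k \<cdot> fib_proj C t f \<and> e \<cdot> u = h)
        \<longleftrightarrow> (e \<cdot> v) \<cdot> fib_arr C t (f, k, \<gamma>) = h"
      if k: "k \<in> Hom C (Dom C f) (Dom C \<gamma>)" "\<gamma> \<cdot> k = f" for k
    proof -
      let ?w = "fib_arr C t (f, k, \<gamma>)"
      have w: "?w \<in> Hom C (fib_obj C t f) (fib_obj C t \<gamma>)"
        "fib_proj C t \<gamma> \<cdot> ?w = k \<cdot> fib_proj C t f"
        using fib_arr(1,2)[of f \<gamma> t k] k f \<gamma> t by auto
      have vw: "v \<cdot> ?w \<in> Hom C (fib_obj C t f) (Dom C p)" using w v by (simp add: Hom_def)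
      have "p \<cdot> v \<cdot> ?w = (p \<cdot> v) \<cdot> ?w" using w v(1-3) P by (simp add: Hom_def)
      then have pvw: "p \<cdot> v \<cdot> ?w = k \<cdot> fib_proj C t f" using w v(4) by simp
      have "u = v \<cdot> ?w" if "u \<in> Hom C (fib_obj C t f) (Dom C p)" "p \<cdot> u = k \<cdot> fib_proj C t f" for u
        using fiber_mono[OF p that(1) vw] that(2) pvw by simp
      moreover have "(e \<cdot> v) \<cdot> ?w = e \<cdot> v \<cdot> ?w" using e v w by (simp add: Hom_def)
      ultimately show ?thesis using vw pvw by metis
    qed
    have "\<exists>!k. k \<in> Hom C (Dom C f) (Dom C \<gamma>) \<and> \<gamma> \<cdot> k = f \<and>
        (e \<cdot> v) \<cdot> fib_arr C t (f, k, \<gamma>) = h"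
      using univ[OF f fp[OF f]] h equiv unfolding fib_obj_def by (metis (no_types, lifting))
    then show ?thesis using f \<gamma> by (auto simp: Hom_slice)
  qed
  then show ?thesis
    using \<gamma> v e by (intro exI[of _ "e \<cdot> v"]) (auto simp: couniversal_def slice_def Hom_def)
qed

text \<open>Now the fiber \<open>q\<close> of \<open>f\<close> is arbitrary, while \<gamma> keeps
  its chosen one. The map \<open>h\<close> is carried to the chosen fiber of \<open>f\<close> along
  \<open>v\<close>, and the resulting fiber map is carried back along \<open>v'\<close>.\<close>

lemma cofree_over_of_couniversal:
  assumes t: "t \<in> Points C T"
    and couni: "couniversal (slice C T) C (fib_obj C t) (fib_arr C t) I \<gamma> e"
  shows "cofree_over C T t I \<gamma> (fib_proj C t \<gamma>) e"
proof -
  have \<gamma>: "\<gamma> \<in> Arr C" "Cod C \<gamma> = T" and e: "e \<in> Hom C (fib_obj C t \<gamma>) I"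
    and univ: "\<And>f h. f \<in> Arr C \<Longrightarrow> Cod C f = T \<Longrightarrow> h \<in> Hom C (fib_obj C t f) I \<Longrightarrow>
        \<exists>!x. x \<in> Hom (slice C T) f \<gamma> \<and> e \<cdot> fib_arr C t x = h"
    using couni by (auto simp: couniversal_def slice_def)
  have fp: "is_fiber C f t (fib_proj C t f)" if "f \<in> Arr C" "Cod C f = T" for f
    using is_fiber_fib_proj that t by simp
  note P = is_fiberD[OF fp[OF \<gamma>]]
  have "\<exists>!k. k \<in> Hom C (Dom C f) (Dom C \<gamma>) \<and> \<gamma> \<cdot> k = f \<and>
      (\<exists>u \<in> Hom C (Dom C q) (fib_obj C t \<gamma>). fib_proj C t \<gamma> \<cdot> u = k \<cdot> q \<and> e \<cdot> u = h)"
    if f: "f \<in> Arr C" "Cod C f = T" and q: "is_fiber C f t q" and h: "h \<in> Hom C (Dom C q) I" for f q h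
  proof -
    note Q = is_fiberD[OF q] and F = is_fiberD[OF fp[OF f]]
    obtain v v' where v: "v \<in> Hom C (fib_obj C t f) (Dom C q)" "v' \<in> Hom C (Dom C q) (fib_obj C t f)"
        "fib_proj C t f = q \<cdot> v" "q = fib_proj C t f \<cdot> v'" "v \<cdot> v' = Id C (Dom C q)"
      using fibers_iso[OF q fp[OF f]] unfolding fib_obj_def by metis
    have hv: "h \<cdot> v \<in> Hom C (fib_obj C t f) I" using Comp_Hom[OF v(1) h] .
    have equiv: "(\<exists>u \<in> Hom C (Dom C q) (fib_obj C t \<gamma>). fib_proj C t \<gamma> \<cdot> u = k \<cdot> q \<and> e \<cdot> u = h)
        \<longleftrightarrow> e \<cdot> fib_arr C t (f, k, \<gamma>) = h \<cdot> v"
      if k: "k \<in> Hom C (Dom C f) (Dom C \<gamma>)" "\<gamma> \<cdot> k = f" for k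
    proof -
      let ?w = "fib_arr C t (f, k, \<gamma>)"
      have w: "?w \<in> Hom C (fib_obj C t f) (fib_obj C t \<gamma>)"
        "fib_proj C t \<gamma> \<cdot> ?w = k \<cdot> fib_proj C t f"
        using fib_arr(1,2)[of f \<gamma> t k] k f \<gamma> t by auto
      have proj: "fib_proj C t \<gamma> \<in> Hom C (fib_obj C t \<gamma>) (Dom C \<gamma>)"
        "fib_proj C t f \<in> Hom C (fib_obj C t f) (Dom C f)" "q \<in> Hom C (Dom C q) (Dom C f)"
        using P Q F by (auto simp: fib_obj_def Hom_def)
      show ?thesis
      proof
        assume "\<exists>u \<in> Hom C (Dom C q) (fib_obj C t \<gamma>). fib_proj C t \<gamma> \<cdot> u = k \<cdot> q \<and> e \<cdot> u = h"
        then obtain u where u: "u \<in> Hom C (Dom C q) (fib_obj C t \<gamma>)"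
            "fib_proj C t \<gamma> \<cdot> u = k \<cdot> q" "e \<cdot> u = h"
          by blast
        have "fib_proj C t \<gamma> \<cdot> u \<cdot> v = k \<cdot> fib_proj C t f"
          using Comp_assoc[OF v(1) u(1) proj(1)] Comp_assoc[OF v(1) proj(3) k(1)] u(2) v(3) by simp
        then have "?w = u \<cdot> v"
          using k f \<gamma> t Comp_Hom[OF v(1) u(1)] by (intro fib_arr(3)) auto
        then show "e \<cdot> ?w = h \<cdot> v" using Comp_assoc[OF v(1) u(1) e] u(3) by simp
      next
        assume ew: "e \<cdot> ?w = h \<cdot> v"
        have "fib_proj C t \<gamma> \<cdot> ?w \<cdot> v' = k \<cdot> q"
          using Comp_assoc[OF v(2) w(1) proj(1)] Comp_assoc[OF v(2) proj(2) k(1)] w(2) v(4) by simp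
        moreover have "e \<cdot> ?w \<cdot> v' = h"
          using Comp_assoc[OF v(2) w(1) e] ew Comp_assoc[OF v(2,1) h] v(5) h by (simp add: Comp_Id)
        ultimately show "\<exists>u \<in> Hom C (Dom C q) (fib_obj C t \<gamma>). fib_proj C t \<gamma> \<cdot> u = k \<cdot> q \<and> e \<cdot> u = h"
          using Comp_Hom[OF v(2) w(1)] by blast
      qed
    qed
    have "\<exists>!k. k \<in> Hom C (Dom C f) (Dom C \<gamma>) \<and> \<gamma> \<cdot> k = f \<and> e \<cdot> fib_arr C t (f, k, \<gamma>) = h \<cdot> v"
      using univ[OF f hv] f \<gamma> unfolding Hom_slice by auto
    then show ?thesis using equiv by (metis (no_types, lifting))
  qed
  then show ?thesis
    using \<gamma> e fp[OF \<gamma>] unfolding cofree_over_def fib_obj_def by blast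
qed

lemma has_right_adjoint_fib_iff:
  assumes "t \<in> Points C T"
  shows "has_right_adjoint (slice C T) C (fib_obj C t) (fib_arr C t) \<longleftrightarrow>
    (\<forall>I \<in> Obj C. \<exists>\<gamma> p e. cofree_over C T t I \<gamma> p e)"
  using couniversal_of_cofree_over[OF assms] cofree_over_of_couniversal[OF assms]
    cat_functor.has_right_adjointI[OF fib_functor[OF assms]] has_right_adjointD
  by metis

text \<open>The domain of a point \<open>i\<close> is \<open>One C\<close>, so the commuting square
  of the fiber is the equation \<open>f \<cdot> i = t\<close>; arrows of \<open>pointed C\<close>
  into \<open>(T, t)\<close> thus correspond to arrows \<open>f\<close> with that fiber.\<close>

lemma point_classifier_iff:
  "point_classifier C T t \<longleftrightarrow> T \<in> Obj C \<and> t \<in> Points C T \<and>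
     (\<forall>I \<in> Obj C. \<forall>i \<in> Points C I. \<exists>!f. f \<in> Hom C I T \<and> is_fiber C f t i)"
proof -
  have arr: "x \<in> Hom (pointed C) (I, i) (T, t) \<longleftrightarrow>
      (\<exists>f. x = ((I, i), f, (T, t)) \<and> f \<in> Hom C I T \<and> is_fiber C f t i)"
    if "i \<in> Points C I" "t \<in> Points C T" for x I i
  proof -
    have "f \<cdot> i = t" if f: "f \<in> Hom C I T" "is_fiber C f t i" for f
      using is_fiberD[OF f(2)] f(1) \<open>i \<in> Points C I\<close> by (simp add: Points_iff Hom_def)
    then show ?thesis using that by (auto simp: Hom_def pointed_def Points_def)
  qed
  then have "(\<exists>!x. x \<in> Hom (pointed C) (I, i) (T, t)) \<longleftrightarrow>
      (\<exists>!f. f \<in> Hom C I T \<and> is_fiber C f t i)"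
    if "i \<in> Points C I" "t \<in> Points C T" for I i
    using that by auto
  moreover have "(T, t) \<in> Obj (pointed C) \<longleftrightarrow> T \<in> Obj C \<and> t \<in> Points C T"
    "(\<forall>a \<in> Obj (pointed C). P a) \<longleftrightarrow> (\<forall>I \<in> Obj C. \<forall>i \<in> Points C I. P (I, i))" for P
    by (auto simp: pointed_def)
  ultimately show ?thesis
    unfolding point_classifier_def is_terminal_def by (simp cong: conj_cong)
qed

end

text \<open>The working form of perfection, free of slices and chosen fibers: it opens both
  hypotheses and closes the final goal.\<close>

lemma perfect_operator_category_iff:
  "perfect_operator_category C \<longleftrightarrow> operator_category C \<and>
     (\<exists>T t. point_classifier C T t \<and> (\<forall>I \<in> Obj C. \<exists>\<gamma> p e. cofree_over C T t I \<gamma> p e))"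
  using operator_category.has_right_adjoint_fib_iff operator_category.point_classifier_iff
  unfolding perfect_operator_category_def perfect_operator_category_axioms_def by metis


section \<open>Wreath products\<close>

text \<open>Families are extensional, so equations between arrows of the wreath product are checked
  pointwise.\<close>

lemma restrict_eq_iff: "g \<in> extensional A \<Longrightarrow> restrict f A = g \<longleftrightarrow> (\<forall>x \<in> A. f x = g x)"
  by (metis extensionalityI restrict_apply' restrict_extensional)

section \<open>The wreath product as a category with a terminal object\<close>

locale operator_category_pair = P: operator_category \<Phi> + Q: operator_category \<Psi>
  for \<Phi> :: "('o, 'm) opcat" and \<Psi> :: "('p, 'n) opcat"
begin

abbreviation W where "W \<equiv> \<Psi> \<wr> \<Phi>"

lemma wreath_simps [simp]:
  "Obj W = wreath_obj \<Psi> \<Phi>"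
  "Dom W (x, f, y) = x"
  "Cod W (x, f, y) = y"
  "One W = (One \<Phi>, \<lambda>i \<in> Points \<Phi> (One \<Phi>). One \<Psi>)"
  "Id W (I, M) = ((I, M), (Id \<Phi> I, \<lambda>i \<in> Points \<Phi> I. Id \<Psi> (M i)), (I, M))"
  "(y, (\<eta>', \<omega>'), z) \<cdot>\<^bsub>W\<^esub> ((J, N), (\<eta>, \<omega>), y') =
     ((J, N), (\<eta>' \<cdot>\<^bsub>\<Phi>\<^esub> \<eta>, \<lambda>j \<in> Points \<Phi> J. \<omega>' (\<eta> \<cdot>\<^bsub>\<Phi>\<^esub> j) \<cdot>\<^bsub>\<Psi>\<^esub> \<omega> j), z)"
  by (simp_all add: wreath_def)

definition is_wreath_arr where
  "is_wreath_arr J N \<eta> \<omega> I M \<longleftrightarrow> I \<in> Obj \<Phi> \<and> J \<in> Obj \<Phi> \<and>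
     M \<in> Points \<Phi> I \<rightarrow>\<^sub>E Obj \<Psi> \<and> N \<in> Points \<Phi> J \<rightarrow>\<^sub>E Obj \<Psi> \<and>
     \<eta> \<in> Hom \<Phi> J I \<and> \<omega> \<in> (\<Pi>\<^sub>E j \<in> Points \<Phi> J. Hom \<Psi> (N j) (M (\<eta> \<cdot>\<^bsub>\<Phi>\<^esub> j)))"

lemma Arr_wreath: "((J, N), (\<eta>, \<omega>), (I, M)) \<in> Arr W \<longleftrightarrow> is_wreath_arr J N \<eta> \<omega> I M"
  by (auto simp: wreath_def wreath_obj_def is_wreath_arr_def)

lemma wreath_ArrE:
  assumes "f \<in> Arr W"
  obtains J N \<eta> \<omega> I M where "f = ((J, N), (\<eta>, \<omega>), (I, M))" "is_wreath_arr J N \<eta> \<omega> I M"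
proof -
  obtain J N \<eta> \<omega> I M where "f = ((J, N), (\<eta>, \<omega>), (I, M))" by (metis prod.exhaust)
  then show ?thesis using assms Arr_wreath that by blast
qed

lemma Hom_wreath:
  "f \<in> Hom W (J, N) (I, M) \<longleftrightarrow>
     (\<exists>\<eta> \<omega>. f = ((J, N), (\<eta>, \<omega>), (I, M)) \<and> is_wreath_arr J N \<eta> \<omega> I M)"
  by (auto simp: Hom_def Arr_wreath elim!: wreath_ArrE)

lemma Obj_wreath: "(I, M) \<in> wreath_obj \<Psi> \<Phi> \<longleftrightarrow> I \<in> Obj \<Phi> \<and> M \<in> Points \<Phi> I \<rightarrow>\<^sub>E Obj \<Psi>"
  by (simp add: wreath_obj_def)

lemma is_wreath_arrD:
  assumes "is_wreath_arr J N \<eta> \<omega> I M"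
  shows "I \<in> Obj \<Phi>" "J \<in> Obj \<Phi>" "\<eta> \<in> Arr \<Phi>" "Dom \<Phi> \<eta> = J" "Cod \<Phi> \<eta> = I"
    "\<omega> \<in> extensional (Points \<Phi> J)" "M \<in> extensional (Points \<Phi> I)" "N \<in> extensional (Points \<Phi> J)"
    "\<And>i. i \<in> Points \<Phi> I \<Longrightarrow> M i \<in> Obj \<Psi>" "\<And>j. j \<in> Points \<Phi> J \<Longrightarrow> N j \<in> Obj \<Psi>"
  using assms by (auto simp: is_wreath_arr_def Hom_def PiE_iff)

lemma is_wreath_arr_point:
  assumes "is_wreath_arr J N \<eta> \<omega> I M" "j \<in> Points \<Phi> J"
  shows "\<omega> j \<in> Hom \<Psi> (N j) (M (\<eta> \<cdot>\<^bsub>\<Phi>\<^esub> j))" "\<eta> \<cdot>\<^bsub>\<Phi>\<^esub> j \<in> Points \<Phi> I"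
    "\<omega> j \<in> Arr \<Psi>" "Dom \<Psi> (\<omega> j) = N j" "Cod \<Psi> (\<omega> j) = M (\<eta> \<cdot>\<^bsub>\<Phi>\<^esub> j)"
  using assms by (auto simp: is_wreath_arr_def Hom_def P.Points_iff PiE_iff)

lemma is_wreath_arr_Id:
  "(I, M) \<in> wreath_obj \<Psi> \<Phi> \<Longrightarrow> is_wreath_arr I M (Id \<Phi> I) (\<lambda>i \<in> Points \<Phi> I. Id \<Psi> (M i)) I M"
  by (auto simp: is_wreath_arr_def Obj_wreath Hom_def P.Points_iff PiE_iff)

lemma is_wreath_arr_Comp:
  assumes f: "is_wreath_arr J N \<eta> \<omega> I M" and g: "is_wreath_arr I M \<eta>' \<omega>' H L"
  shows "is_wreath_arr J N (\<eta>' \<cdot>\<^bsub>\<Phi>\<^esub> \<eta>) (\<lambda>j \<in> Points \<Phi> J. \<omega>' (\<eta> \<cdot>\<^bsub>\<Phi>\<^esub> j) \<cdot>\<^bsub>\<Psi>\<^esub> \<omega> j) H L"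
proof -
  have "\<omega>' (\<eta> \<cdot>\<^bsub>\<Phi>\<^esub> j) \<cdot>\<^bsub>\<Psi>\<^esub> \<omega> j \<in> Hom \<Psi> (N j) (L ((\<eta>' \<cdot>\<^bsub>\<Phi>\<^esub> \<eta>) \<cdot>\<^bsub>\<Phi>\<^esub> j))" if j: "j \<in> Points \<Phi> J" for j
    using Q.Comp_Hom[OF is_wreath_arr_point(1)[OF f j] is_wreath_arr_point(1)[OF g is_wreath_arr_point(2)[OF f j]]]
      is_wreath_arrD[OF f] is_wreath_arrD[OF g] j by (simp add: P.Points_iff)
  then show ?thesis using f g P.Comp_Hom by (auto simp: is_wreath_arr_def)
qed

lemma category_wreath: "category W"
proof
  fix f assume "f \<in> Arr W"
  then show "Dom W f \<in> Obj W" "Cod W f \<in> Obj W"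
    by (auto simp: Obj_wreath is_wreath_arr_def elim!: wreath_ArrE)
next
  fix a assume "a \<in> Obj W"
  then show "Id W a \<in> Hom W a a" by (cases a) (simp add: Hom_wreath is_wreath_arr_Id)
next
  fix f a b g c assume "f \<in> Hom W a b" "g \<in> Hom W b c"
  then show "g \<cdot>\<^bsub>W\<^esub> f \<in> Hom W a c"
    by (cases a; cases b; cases c) (auto simp: Hom_wreath is_wreath_arr_Comp)
next
  fix f a b assume "f \<in> Hom W a b"
  then obtain J N \<eta> \<omega> I M where f: "f = ((J, N), (\<eta>, \<omega>), (I, M))" "a = (J, N)" "b = (I, M)"
      "is_wreath_arr J N \<eta> \<omega> I M"
    by (cases a; cases b) (auto simp: Hom_wreath)
  note D = is_wreath_arrD[OF f(4)] is_wreath_arr_point[OF f(4)]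
  show "f \<cdot>\<^bsub>W\<^esub> Id W a = f" "Id W b \<cdot>\<^bsub>W\<^esub> f = f"
    using D by (simp_all add: f restrict_eq_iff) (simp_all add: P.Points_iff)
next
  fix f a b g c h d assume "f \<in> Hom W a b" "g \<in> Hom W b c" "h \<in> Hom W c d"
  then obtain A A' f0 f1 B B' g0 g1 C C' h0 h1 E E' where
      f: "f = ((A, A'), (f0, f1), (B, B'))" "is_wreath_arr A A' f0 f1 B B'" and
      g: "g = ((B, B'), (g0, g1), (C, C'))" "is_wreath_arr B B' g0 g1 C C'" and
      h: "h = ((C, C'), (h0, h1), (E, E'))" "is_wreath_arr C C' h0 h1 E E'"
    by (cases a; cases b; cases c; cases d) (auto simp: Hom_wreath)
  \<comment> \<open>The two sides are indexed by differently bracketed composites in \<Phi>; these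
    are aligned before associativity in \<Psi> can apply.\<close>
  have "(h1 (g0 \<cdot>\<^bsub>\<Phi>\<^esub> f0 \<cdot>\<^bsub>\<Phi>\<^esub> j) \<cdot>\<^bsub>\<Psi>\<^esub> g1 (f0 \<cdot>\<^bsub>\<Phi>\<^esub> j)) \<cdot>\<^bsub>\<Psi>\<^esub> f1 j =
      h1 ((g0 \<cdot>\<^bsub>\<Phi>\<^esub> f0) \<cdot>\<^bsub>\<Phi>\<^esub> j) \<cdot>\<^bsub>\<Psi>\<^esub> g1 (f0 \<cdot>\<^bsub>\<Phi>\<^esub> j) \<cdot>\<^bsub>\<Psi>\<^esub> f1 j" if j: "j \<in> Points \<Phi> A" for j
  proof -
    note F = is_wreath_arr_point[OF f(2) j]
    note G = is_wreath_arr_point[OF g(2) F(2)]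
    note H = is_wreath_arr_point[OF h(2) G(2)]
    have "(g0 \<cdot>\<^bsub>\<Phi>\<^esub> f0) \<cdot>\<^bsub>\<Phi>\<^esub> j = g0 \<cdot>\<^bsub>\<Phi>\<^esub> f0 \<cdot>\<^bsub>\<Phi>\<^esub> j"
      using is_wreath_arrD[OF f(2)] is_wreath_arrD[OF g(2)] j by (simp add: P.Points_iff)
    then show ?thesis using F G H by simp
  qed
  moreover have "f0 \<cdot>\<^bsub>\<Phi>\<^esub> j \<in> Points \<Phi> B" if "j \<in> Points \<Phi> A" for j
    using is_wreath_arr_point(2)[OF f(2) that] .
  ultimately show "(h \<cdot>\<^bsub>W\<^esub> g) \<cdot>\<^bsub>W\<^esub> f = h \<cdot>\<^bsub>W\<^esub> g \<cdot>\<^bsub>W\<^esub> f"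
    using is_wreath_arrD(3-5)[OF f(2)] is_wreath_arrD(3-5)[OF g(2)] is_wreath_arrD(3-5)[OF h(2)]
    by (auto simp: f g h intro!: restrict_ext)
qed

lemma is_wreath_arr_One:
  "is_wreath_arr J N \<eta> \<omega> (One \<Phi>) (\<lambda>i \<in> Points \<Phi> (One \<Phi>). One \<Psi>) \<longleftrightarrow> (J, N) \<in> wreath_obj \<Psi> \<Phi> \<and>
     \<eta> = bang \<Phi> J \<and> \<omega> = (\<lambda>j \<in> Points \<Phi> J. bang \<Psi> (N j))"
proof -
  have "\<omega> \<in> (\<Pi>\<^sub>E j \<in> Points \<Phi> J. Hom \<Psi> (N j) (One \<Psi>)) \<longleftrightarrow>
      \<omega> = (\<lambda>j \<in> Points \<Phi> J. bang \<Psi> (N j))" if "N \<in> Points \<Phi> J \<rightarrow>\<^sub>E Obj \<Psi>"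
  proof
    assume "\<omega> \<in> (\<Pi>\<^sub>E j \<in> Points \<Phi> J. Hom \<Psi> (N j) (One \<Psi>))"
    then have "restrict (\<lambda>j. bang \<Psi> (N j)) (Points \<Phi> J) = \<omega>"
      using Q.bang_unique[symmetric]
      by (subst restrict_eq_iff) (auto simp: PiE_iff Hom_def)
    then show "\<omega> = (\<lambda>j \<in> Points \<Phi> J. bang \<Psi> (N j))" by simp
  qed (use that Q.bang_Hom in auto)
  moreover have "\<eta> \<in> Hom \<Phi> J (One \<Phi>) \<longleftrightarrow> \<eta> = bang \<Phi> J" if "J \<in> Obj \<Phi>"
    using P.bang_Hom[OF that] P.bang_unique[of \<eta> J] by (auto simp: Hom_def)
  moreover have "bang \<Phi> J \<cdot>\<^bsub>\<Phi>\<^esub> j = Id \<Phi> (One \<Phi>)" if "J \<in> Obj \<Phi>" "j \<in> Points \<Phi> J" for j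
    using that by (simp add: P.Points_iff)
  ultimately show ?thesis
    by (auto simp: is_wreath_arr_def Obj_wreath PiE_iff cong: conj_cong)
qed

sublocale W: category_with_One W
proof (rule category_with_One.intro[OF category_wreath], unfold_locales)
  show "is_terminal W (One W)"
    unfolding is_terminal_def
  proof (intro conjI ballI)
    show "One W \<in> Obj W" by (auto simp: Obj_wreath)
    fix a assume "a \<in> Obj W"
    then show "\<exists>!f. f \<in> Hom W a (One W)"
      \<comment> \<open>The simplifier turns the points of \<open>One \<Phi>\<close> into a
        singleton, so the rule is first brought to that shape.\<close>
      by (cases a) (simp add: Hom_wreath is_wreath_arr_One[unfolded P.Points_One])
  qed
qed

section \<open>Points and fibers of the wreath product\<close>

lemma bang_wreath:
  assumes "(J, N) \<in> wreath_obj \<Psi> \<Phi>"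
  shows "bang W (J, N) = ((J, N), (bang \<Phi> J, \<lambda>j \<in> Points \<Phi> J. bang \<Psi> (N j)), One W)"
  using assms is_wreath_arr_One[of J N]
  by (intro W.bang_unique[symmetric]) (simp_all add: Arr_wreath)

text \<open>The family is constant because \<open>One \<Phi>\<close> has a single point; all it
  carries is one point \<open>x\<close> of \<open>M i\<close>.\<close>

definition wreath_point where
  "wreath_point I M i x = (One W, (i, \<lambda>_ \<in> Points \<Phi> (One \<Phi>). x), (I, M))"

lemma Points_wreath:
  "X \<in> Points W (I, M) \<longleftrightarrow> (I, M) \<in> wreath_obj \<Psi> \<Phi> \<and>
     (\<exists>i \<in> Points \<Phi> I. \<exists>x \<in> Points \<Psi> (M i). X = wreath_point I M i x)"
proof -
  have "is_wreath_arr (One \<Phi>) (\<lambda>i \<in> Points \<Phi> (One \<Phi>). One \<Psi>) \<eta> \<omega> I M \<longleftrightarrow> (I, M) \<in> wreath_obj \<Psi> \<Phi> \<and>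
      \<eta> \<in> Points \<Phi> I \<and> (\<exists>x \<in> Points \<Psi> (M \<eta>). \<omega> = (\<lambda>_ \<in> Points \<Phi> (One \<Phi>). x))" for \<eta> \<omega>
  proof -
    have "\<omega> = (\<lambda>_ \<in> {Id \<Phi> (One \<Phi>)}. \<omega> (Id \<Phi> (One \<Phi>)))" if "\<omega> \<in> extensional {Id \<Phi> (One \<Phi>)}"
      using that restrict_eq_iff[of \<omega> "{Id \<Phi> (One \<Phi>)}" "\<lambda>_. \<omega> (Id \<Phi> (One \<Phi>))"] by simp
    then show ?thesis
      by (auto simp: is_wreath_arr_def Obj_wreath Points_def[of \<Phi> I] Points_def[of \<Psi>] Hom_def PiE_iff)
  qed
  then show ?thesis
    by (auto simp: Points_def[of W] Hom_wreath wreath_point_def)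
qed

text \<open>\<open>bang \<Phi> H\<close> sends every point \<open>l\<close> to the single point of
  \<open>One \<Phi>\<close>, so the same \<open>x\<close> occurs at every \<open>l\<close>, and
  lying over the point splits into a condition in \<Phi> and one in \<Psi> for each
  \<open>l\<close>.\<close>

lemma Comp_eq_wreath_point:
  assumes f: "is_wreath_arr J N \<eta> \<omega> I M" and y: "is_wreath_arr H L y \<upsilon> J N"
    and i: "i \<in> Points \<Phi> I" and x: "x \<in> Points \<Psi> (M i)"
  shows "((J, N), (\<eta>, \<omega>), (I, M)) \<cdot>\<^bsub>W\<^esub> ((H, L), (y, \<upsilon>), (J, N)) = wreath_point I M i x \<cdot>\<^bsub>W\<^esub> bang W (H, L) \<longleftrightarrow>
    \<eta> \<cdot>\<^bsub>\<Phi>\<^esub> y = i \<cdot>\<^bsub>\<Phi>\<^esub> bang \<Phi> H \<and>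
    (\<forall>l \<in> Points \<Phi> H. \<omega> (y \<cdot>\<^bsub>\<Phi>\<^esub> l) \<cdot>\<^bsub>\<Psi>\<^esub> \<upsilon> l = x \<cdot>\<^bsub>\<Psi>\<^esub> bang \<Psi> (L l))"
proof -
  have HL: "(H, L) \<in> wreath_obj \<Psi> \<Phi>" using y by (simp add: is_wreath_arr_def Obj_wreath)
  have "bang \<Phi> H \<cdot>\<^bsub>\<Phi>\<^esub> l = Id \<Phi> (One \<Phi>)" if "l \<in> Points \<Phi> H" for l
    using that HL by (simp add: P.Points_iff Obj_wreath)
  then show ?thesis
    unfolding bang_wreath[OF HL] wreath_point_def by (simp add: restrict_eq_iff cong: ball_cong)
qed

text \<open>The lift \<open>u\<close> in \<Phi> decides through which fiber
  \<open>\<rho> (u \<cdot> l)\<close> the component at \<open>l\<close> has to be lifted; after that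
  the components are independent of each other.\<close>

lemma is_fiber_wreathI:
  assumes f: "is_wreath_arr J N \<eta> \<omega> I M" and p: "is_wreath_arr K L p \<rho> J N"
    and i: "i \<in> Points \<Phi> I" and x: "x \<in> Points \<Psi> (M i)"
    and fib: "is_fiber \<Phi> \<eta> i p" "\<And>k. k \<in> Points \<Phi> K \<Longrightarrow> is_fiber \<Psi> (\<omega> (p \<cdot>\<^bsub>\<Phi>\<^esub> k)) x (\<rho> k)"
  shows "is_fiber W ((J, N), (\<eta>, \<omega>), (I, M)) (wreath_point I M i x) ((K, L), (p, \<rho>), (J, N))"
proof -
  note F = is_wreath_arrD[OF f] and P = is_wreath_arrD[OF p] is_wreath_arr_point[OF p]
  have comm: "((J, N), (\<eta>, \<omega>), (I, M)) \<cdot>\<^bsub>W\<^esub> ((K, L), (p, \<rho>), (J, N)) = wreath_point I M i x \<cdot>\<^bsub>W\<^esub> bang W (K, L)"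
    unfolding Comp_eq_wreath_point[OF f p i x]
    using P.is_fiberD(5)[OF fib(1)] Q.is_fiberD(5)[OF fib(2)] P by simp
  have univ: "\<exists>!u. u \<in> Hom W (Dom W Y) (K, L) \<and> ((K, L), (p, \<rho>), (J, N)) \<cdot>\<^bsub>W\<^esub> u = Y"
    if Y: "Y \<in> Arr W" "Cod W Y = (J, N)"
      and eq: "((J, N), (\<eta>, \<omega>), (I, M)) \<cdot>\<^bsub>W\<^esub> Y = wreath_point I M i x \<cdot>\<^bsub>W\<^esub> bang W (Dom W Y)" for Y
  proof -
    obtain H A y \<upsilon> where Yeq: "Y = ((H, A), (y, \<upsilon>), (J, N))" and y: "is_wreath_arr H A y \<upsilon> J N"
      using Y by (auto elim!: wreath_ArrE)
    note D = is_wreath_arrD[OF y] is_wreath_arr_point[OF y]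
    have e0: "\<eta> \<cdot>\<^bsub>\<Phi>\<^esub> y = i \<cdot>\<^bsub>\<Phi>\<^esub> bang \<Phi> H"
      and e1: "\<And>l. l \<in> Points \<Phi> H \<Longrightarrow> \<omega> (y \<cdot>\<^bsub>\<Phi>\<^esub> l) \<cdot>\<^bsub>\<Psi>\<^esub> \<upsilon> l = x \<cdot>\<^bsub>\<Psi>\<^esub> bang \<Psi> (A l)"
      using eq Comp_eq_wreath_point[OF f y i x] by (simp_all add: Yeq)
    obtain u where u: "u \<in> Arr \<Phi>" "Dom \<Phi> u = H" "Cod \<Phi> u = K" "p \<cdot>\<^bsub>\<Phi>\<^esub> u = y"
      using P.fiber_lift[OF fib(1), of y] e0 D P F by metis
    have pul: "p \<cdot>\<^bsub>\<Phi>\<^esub> u \<cdot>\<^bsub>\<Phi>\<^esub> l = y \<cdot>\<^bsub>\<Phi>\<^esub> l" and ul: "u \<cdot>\<^bsub>\<Phi>\<^esub> l \<in> Points \<Phi> K" if "l \<in> Points \<Phi> H" for l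
      using P.Comp_assoc_Arr[of l u p] u P that by (simp_all add: P.Points_iff)
    have "\<exists>\<nu>. \<nu> \<in> Hom \<Psi> (A l) (L (u \<cdot>\<^bsub>\<Phi>\<^esub> l)) \<and> \<rho> (u \<cdot>\<^bsub>\<Phi>\<^esub> l) \<cdot>\<^bsub>\<Psi>\<^esub> \<nu> = \<upsilon> l" if l: "l \<in> Points \<Phi> H" for l
    proof -
      have "is_fiber \<Psi> (\<omega> (y \<cdot>\<^bsub>\<Phi>\<^esub> l)) x (\<rho> (u \<cdot>\<^bsub>\<Phi>\<^esub> l))" using fib(2)[OF ul[OF l]] pul[OF l] by simp
      from Q.fiber_lift_unique[OF this, of "\<upsilon> l"] show ?thesis
        using e1[OF l] D l P ul[OF l] is_wreath_arr_point[OF f, of "y \<cdot>\<^bsub>\<Phi>\<^esub> l"] by auto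
    qed
    then obtain \<nu> where \<nu>: "\<And>l. l \<in> Points \<Phi> H \<Longrightarrow> \<nu> l \<in> Hom \<Psi> (A l) (L (u \<cdot>\<^bsub>\<Phi>\<^esub> l))"
        "\<And>l. l \<in> Points \<Phi> H \<Longrightarrow> \<rho> (u \<cdot>\<^bsub>\<Phi>\<^esub> l) \<cdot>\<^bsub>\<Psi>\<^esub> \<nu> l = \<upsilon> l"
      by metis
    have U: "is_wreath_arr H A u (restrict \<nu> (Points \<Phi> H)) K L"
      using p y u \<nu> by (auto simp: is_wreath_arr_def Hom_def)
    show ?thesis
    proof (intro ex1I conjI)
      show "((H, A), (u, restrict \<nu> (Points \<Phi> H)), (K, L)) \<in> Hom W (Dom W Y) (K, L)"
        using U by (simp add: Yeq Hom_wreath)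
      show "((K, L), (p, \<rho>), (J, N)) \<cdot>\<^bsub>W\<^esub> ((H, A), (u, restrict \<nu> (Points \<Phi> H)), (K, L)) = Y"
        using u \<nu> D by (simp add: Yeq restrict_eq_iff)
    next
      fix V assume "V \<in> Hom W (Dom W Y) (K, L) \<and> ((K, L), (p, \<rho>), (J, N)) \<cdot>\<^bsub>W\<^esub> V = Y"
      then obtain v \<mu> where V: "V = ((H, A), (v, \<mu>), (K, L))" "is_wreath_arr H A v \<mu> K L"
          "p \<cdot>\<^bsub>\<Phi>\<^esub> v = y" "\<And>l. l \<in> Points \<Phi> H \<Longrightarrow> \<rho> (v \<cdot>\<^bsub>\<Phi>\<^esub> l) \<cdot>\<^bsub>\<Psi>\<^esub> \<mu> l = \<upsilon> l"
        using D by (auto simp: Yeq Hom_wreath restrict_eq_iff)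
      note VD = is_wreath_arrD[OF V(2)] is_wreath_arr_point[OF V(2)]
      \<comment> \<open>The base is settled first: only then do the components at \<open>l\<close>
        share a codomain and become comparable.\<close>
      have vu: "v = u"
        by (rule P.fiber_mono[OF fib(1), of _ H]) (use VD u V P in \<open>auto simp: Hom_def\<close>)
      have "\<nu> l = \<mu> l" if l: "l \<in> Points \<Phi> H" for l
        by (rule Q.fiber_mono[OF fib(2)[OF ul[OF l]], of _ "A l"])
          (use VD(11)[OF l] \<nu> V(4) l P(14)[OF ul[OF l]] in \<open>auto simp: vu\<close>)
      then have "restrict \<nu> (Points \<Phi> H) = \<mu>" using VD by (simp add: restrict_eq_iff)
      then show "V = ((H, A), (u, restrict \<nu> (Points \<Phi> H)), (K, L))" using V(1) vu by simp
    qed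
  qed
  have "wreath_point I M i x \<in> Points W (I, M)"
    using i x f by (auto simp: Points_wreath is_wreath_arr_def Obj_wreath)
  then show ?thesis
    unfolding W.is_fiber_iff using f p comm univ by (simp add: Arr_wreath)
qed

text \<open>Since \<open>\<eta> \<cdot> p \<cdot> k\<close> is \<open>i\<close>, the component at
  \<open>p \<cdot> k\<close> ends in \<open>M i\<close>, where \<open>x\<close> is a point, and
  \<Psi> supplies a fiber there.\<close>

lemma wreath_fiber_exists:
  assumes f: "is_wreath_arr J N \<eta> \<omega> I M" and i: "i \<in> Points \<Phi> I" and x: "x \<in> Points \<Psi> (M i)"
  obtains K L p \<rho> where "is_wreath_arr K L p \<rho> J N" "is_fiber \<Phi> \<eta> i p"
    "\<And>k. k \<in> Points \<Phi> K \<Longrightarrow> is_fiber \<Psi> (\<omega> (p \<cdot>\<^bsub>\<Phi>\<^esub> k)) x (\<rho> k)"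
proof -
  note F = is_wreath_arrD[OF f] is_wreath_arr_point[OF f]
  obtain p where p: "is_fiber \<Phi> \<eta> i p"
    using P.fiber_exists[of \<eta> J I i] F i by (auto simp: Hom_def)
  note PD = P.is_fiberD[OF p]
  have pk: "p \<cdot>\<^bsub>\<Phi>\<^esub> k \<in> Points \<Phi> J" "\<eta> \<cdot>\<^bsub>\<Phi>\<^esub> p \<cdot>\<^bsub>\<Phi>\<^esub> k = i" if "k \<in> Points \<Phi> (Dom \<Phi> p)" for k
    using P.fiber_point[OF p that] F by auto
  have "\<exists>r. is_fiber \<Psi> (\<omega> (p \<cdot>\<^bsub>\<Phi>\<^esub> k)) x r" if "k \<in> Points \<Phi> (Dom \<Phi> p)" for k
    using Q.fiber_exists[OF F(11)[OF pk(1)[OF that]]] pk(2)[OF that] x by simp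
  then obtain r where r: "\<And>k. k \<in> Points \<Phi> (Dom \<Phi> p) \<Longrightarrow> is_fiber \<Psi> (\<omega> (p \<cdot>\<^bsub>\<Phi>\<^esub> k)) x (r k)"
    by metis
  have rD: "r k \<in> Arr \<Psi>" "Cod \<Psi> (r k) = N (p \<cdot>\<^bsub>\<Phi>\<^esub> k)" if "k \<in> Points \<Phi> (Dom \<Phi> p)" for k
    using Q.is_fiberD[OF r[OF that]] F(14)[OF pk(1)[OF that]] by auto
  have "is_wreath_arr (Dom \<Phi> p) (\<lambda>k \<in> Points \<Phi> (Dom \<Phi> p). Dom \<Psi> (r k)) p (restrict r (Points \<Phi> (Dom \<Phi> p))) J N"
    using f PD rD F by (auto simp: is_wreath_arr_def Hom_def)
  then show ?thesis using p r by (intro that) auto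
qed

lemma finite_Hom_wreath:
  assumes "(I, M) \<in> wreath_obj \<Psi> \<Phi>" "(J, N) \<in> wreath_obj \<Psi> \<Phi>"
  shows "finite (Hom W (J, N) (I, M))"
proof -
  have ok: "N j \<in> Obj \<Psi>" "M (\<eta> \<cdot>\<^bsub>\<Phi>\<^esub> j) \<in> Obj \<Psi>"
    if "\<eta> \<in> Hom \<Phi> J I" "j \<in> Points \<Phi> J" for \<eta> j
    using that assms P.Comp_Hom[of j "One \<Phi>" J \<eta> I] by (auto simp: Obj_wreath Points_def)
  let ?S = "SIGMA \<eta>:Hom \<Phi> J I. (\<Pi>\<^sub>E j \<in> Points \<Phi> J. Hom \<Psi> (N j) (M (\<eta> \<cdot>\<^bsub>\<Phi>\<^esub> j)))"
  have "finite ?S"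
    using assms ok by (intro finite_SigmaI finite_PiE)
      (auto simp: Points_def Obj_wreath intro!: P.finite_Hom Q.finite_Hom)
  moreover have "Hom W (J, N) (I, M) \<subseteq> (\<lambda>x. ((J, N), x, (I, M))) ` ?S"
    by (auto simp: Hom_wreath is_wreath_arr_def)
  ultimately show ?thesis using finite_surj by blast
qed

sublocale W: operator_category W
proof (unfold_locales)
  show "is_terminal W (One W)" by (rule W.terminal_One)
  show "finite (Hom W J I)" if "I \<in> Obj W" "J \<in> Obj W" for I J
    using that by (cases I; cases J) (simp add: finite_Hom_wreath)
  show "\<exists>p. is_fiber W f i p" if fi: "f \<in> Hom W J I" "i \<in> Points W I" for f J I i
  proof -
    obtain J0 J1 \<eta> \<omega> I0 I1 i0 x where f: "f = ((J0, J1), (\<eta>, \<omega>), (I0, I1))" "is_wreath_arr J0 J1 \<eta> \<omega> I0 I1"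
      and i: "i = wreath_point I0 I1 i0 x" "i0 \<in> Points \<Phi> I0" "x \<in> Points \<Psi> (I1 i0)"
      using fi by (cases I; cases J) (auto simp: Hom_wreath Points_wreath)
    then show ?thesis
      using wreath_fiber_exists[OF f(2) i(2,3)] is_fiber_wreathI[OF f(2) _ i(2,3)] by metis
  qed
qed

text \<open>From left to right, the given fiber is isomorphic to an assembled one. An isomorphism of
  the wreath product consists of one in \<Phi> and, at each point, one in \<Psi>, and fibers are
  stable under isomorphism.\<close>

lemma is_fiber_wreath_iff:
  assumes f: "is_wreath_arr J N \<eta> \<omega> I M" and p: "is_wreath_arr K L p \<rho> J N"
    and i: "i \<in> Points \<Phi> I" and x: "x \<in> Points \<Psi> (M i)"
  shows "is_fiber W ((J, N), (\<eta>, \<omega>), (I, M)) (wreath_point I M i x) ((K, L), (p, \<rho>), (J, N)) \<longleftrightarrow>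
    is_fiber \<Phi> \<eta> i p \<and> (\<forall>k \<in> Points \<Phi> K. is_fiber \<Psi> (\<omega> (p \<cdot>\<^bsub>\<Phi>\<^esub> k)) x (\<rho> k))"
proof
  let ?f = "((J, N), (\<eta>, \<omega>), (I, M))" and ?p = "((K, L), (p, \<rho>), (J, N))"
  assume L: "is_fiber W ?f (wreath_point I M i x) ?p"
  obtain K0 L0 p0 \<rho>0 where p0: "is_wreath_arr K0 L0 p0 \<rho>0 J N" and fib: "is_fiber \<Phi> \<eta> i p0"
      "\<And>k. k \<in> Points \<Phi> K0 \<Longrightarrow> is_fiber \<Psi> (\<omega> (p0 \<cdot>\<^bsub>\<Phi>\<^esub> k)) x (\<rho>0 k)"
    using wreath_fiber_exists[OF f i x] by metis
  obtain V V' where iso: "V \<in> Hom W (K, L) (K0, L0)" "V' \<in> Hom W (K0, L0) (K, L)"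
      "?p = ((K0, L0), (p0, \<rho>0), (J, N)) \<cdot>\<^bsub>W\<^esub> V" "V \<cdot>\<^bsub>W\<^esub> V' = Id W (K0, L0)" "V' \<cdot>\<^bsub>W\<^esub> V = Id W (K, L)"
    using W.fibers_iso[OF is_fiber_wreathI[OF f p0 i x fib] L] unfolding wreath_simps by metis
  obtain v \<nu> v' \<nu>' where V: "V = ((K, L), (v, \<nu>), (K0, L0))" "is_wreath_arr K L v \<nu> K0 L0"
    and V': "V' = ((K0, L0), (v', \<nu>'), (K, L))" "is_wreath_arr K0 L0 v' \<nu>' K L"
    using iso(1,2) by (auto simp: Hom_wreath)
  note VD = is_wreath_arrD[OF V(2)] and VD' = is_wreath_arrD[OF V'(2)] and P = is_wreath_arrD[OF p]
    and P0 = is_wreath_arrD[OF p0]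
  have *: "p = p0 \<cdot>\<^bsub>\<Phi>\<^esub> v" "v \<cdot>\<^bsub>\<Phi>\<^esub> v' = Id \<Phi> K0" "v' \<cdot>\<^bsub>\<Phi>\<^esub> v = Id \<Phi> K"
    and \<rho>eq: "\<rho> = (\<lambda>k \<in> Points \<Phi> K. \<rho>0 (v \<cdot>\<^bsub>\<Phi>\<^esub> k) \<cdot>\<^bsub>\<Psi>\<^esub> \<nu> k)"
    and r1: "(\<lambda>k \<in> Points \<Phi> K0. \<nu> (v' \<cdot>\<^bsub>\<Phi>\<^esub> k) \<cdot>\<^bsub>\<Psi>\<^esub> \<nu>' k) = (\<lambda>k \<in> Points \<Phi> K0. Id \<Psi> (L0 k))"
    and r2: "(\<lambda>k \<in> Points \<Phi> K. \<nu>' (v \<cdot>\<^bsub>\<Phi>\<^esub> k) \<cdot>\<^bsub>\<Psi>\<^esub> \<nu> k) = (\<lambda>k \<in> Points \<Phi> K. Id \<Psi> (L k))"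
    using iso(3-5) by (auto simp: V V')
  have \<nu>: "\<nu> (v' \<cdot>\<^bsub>\<Phi>\<^esub> k) \<cdot>\<^bsub>\<Psi>\<^esub> \<nu>' k = Id \<Psi> (L0 k)" if "k \<in> Points \<Phi> K0" for k
    using fun_cong[OF r1, of k] that by simp
  have \<nu>': "\<nu>' (v \<cdot>\<^bsub>\<Phi>\<^esub> k) \<cdot>\<^bsub>\<Psi>\<^esub> \<nu> k = Id \<Psi> (L k)" if "k \<in> Points \<Phi> K" for k
    using fun_cong[OF r2, of k] that by simp
  have "is_fiber \<Phi> \<eta> i p"
    unfolding *(1) by (rule P.fiber_Comp_iso[OF fib(1), of v K v'])
      (use VD VD' P0 * in \<open>auto simp: Hom_def\<close>)
  moreover have "is_fiber \<Psi> (\<omega> (p \<cdot>\<^bsub>\<Phi>\<^esub> k)) x (\<rho> k)" if k: "k \<in> Points \<Phi> K" for k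
  proof -
    have vk: "v \<cdot>\<^bsub>\<Phi>\<^esub> k \<in> Points \<Phi> K0" using is_wreath_arr_point(2)[OF V(2) k] .
    have pk: "p \<cdot>\<^bsub>\<Phi>\<^esub> k = p0 \<cdot>\<^bsub>\<Phi>\<^esub> v \<cdot>\<^bsub>\<Phi>\<^esub> k"
      unfolding *(1) using VD P0 k by (simp add: P.Points_iff)
    \<comment> \<open>\<open>\<nu>'\<close> at \<open>v \<cdot> k\<close> ends in
      \<open>L (v' \<cdot> v \<cdot> k)\<close>; this index must be \<open>k\<close> for the arrow
      to be the inverse of \<open>\<nu> k\<close>.\<close>
    have "v' \<cdot>\<^bsub>\<Phi>\<^esub> v \<cdot>\<^bsub>\<Phi>\<^esub> k = (v' \<cdot>\<^bsub>\<Phi>\<^esub> v) \<cdot>\<^bsub>\<Phi>\<^esub> k"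
      using VD VD' k by (simp add: P.Points_iff)
    then have vvk: "v' \<cdot>\<^bsub>\<Phi>\<^esub> v \<cdot>\<^bsub>\<Phi>\<^esub> k = k" using *(3) k by (simp add: P.Points_iff)
    have "is_fiber \<Psi> (\<omega> (p \<cdot>\<^bsub>\<Phi>\<^esub> k)) x (\<rho>0 (v \<cdot>\<^bsub>\<Phi>\<^esub> k) \<cdot>\<^bsub>\<Psi>\<^esub> \<nu> k)"
      unfolding pk
    proof (rule Q.fiber_Comp_iso[OF fib(2)[OF vk], of _ "L k" "\<nu>' (v \<cdot>\<^bsub>\<Phi>\<^esub> k)"])
      have "Dom \<Psi> (\<rho>0 (v \<cdot>\<^bsub>\<Phi>\<^esub> k)) = L0 (v \<cdot>\<^bsub>\<Phi>\<^esub> k)" using is_wreath_arr_point(4)[OF p0 vk] .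
      then show "\<nu> k \<in> Hom \<Psi> (L k) (Dom \<Psi> (\<rho>0 (v \<cdot>\<^bsub>\<Phi>\<^esub> k)))"
        "\<nu>' (v \<cdot>\<^bsub>\<Phi>\<^esub> k) \<in> Hom \<Psi> (Dom \<Psi> (\<rho>0 (v \<cdot>\<^bsub>\<Phi>\<^esub> k))) (L k)"
        "\<nu> k \<cdot>\<^bsub>\<Psi>\<^esub> \<nu>' (v \<cdot>\<^bsub>\<Phi>\<^esub> k) = Id \<Psi> (Dom \<Psi> (\<rho>0 (v \<cdot>\<^bsub>\<Phi>\<^esub> k)))"
        using is_wreath_arr_point(1)[OF V(2) k] is_wreath_arr_point(1)[OF V'(2) vk] \<nu>[OF vk] by (simp_all add: vvk)
      show "\<nu>' (v \<cdot>\<^bsub>\<Phi>\<^esub> k) \<cdot>\<^bsub>\<Psi>\<^esub> \<nu> k = Id \<Psi> (L k)" using \<nu>'[OF k] .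
    qed
    then show ?thesis by (simp add: \<rho>eq k)
  qed
  ultimately show "is_fiber \<Phi> \<eta> i p \<and> (\<forall>k \<in> Points \<Phi> K. is_fiber \<Psi> (\<omega> (p \<cdot>\<^bsub>\<Phi>\<^esub> k)) x (\<rho> k))"
    by blast
qed (use is_fiber_wreathI[OF assms] in blast)

text \<open>The arrow \<chi> classifying \<open>i\<close> in \<Phi> sends no other point to
  \<open>t\<close>. The component at \<open>i\<close> must therefore classify \<open>y\<close> in
  \<Psi>, and all others are the unique arrows to \<open>One \<Psi>\<close>.\<close>

lemma point_classifier_wreath:
  assumes T: "point_classifier \<Phi> T t" and T': "point_classifier \<Psi> T' t'"
  defines "TM \<equiv> \<lambda>s \<in> Points \<Phi> T. if s = t then T' else One \<Psi>"
  shows "point_classifier W (T, TM) (wreath_point T TM t t')"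
  unfolding W.point_classifier_iff
proof (intro conjI ballI)
  have t: "T \<in> Obj \<Phi>" "t \<in> Points \<Phi> T" "T' \<in> Obj \<Psi>" "t' \<in> Points \<Psi> T'"
    using T T' by (auto simp: P.point_classifier_iff Q.point_classifier_iff)
  then show TM: "(T, TM) \<in> Obj W" by (auto simp: TM_def Obj_wreath)
  have TMt: "TM t = T'" using t by (simp add: TM_def)
  show "wreath_point T TM t t' \<in> Points W (T, TM)"
    unfolding Points_wreath using TM t(2) t(4)[folded TMt] by (simp only: wreath_simps) blast
  fix X x assume "X \<in> Obj W" "x \<in> Points W X"
  then obtain I M i y where X: "X = (I, M)" "(I, M) \<in> wreath_obj \<Psi> \<Phi>"
    and x: "x = wreath_point I M i y" "i \<in> Points \<Phi> I" "y \<in> Points \<Psi> (M i)"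
    by (cases X) (auto simp: Points_wreath)
  have IM: "I \<in> Obj \<Phi>" "M \<in> extensional (Points \<Phi> I)" "\<And>j. j \<in> Points \<Phi> I \<Longrightarrow> M j \<in> Obj \<Psi>"
    using X(2) by (auto simp: Obj_wreath PiE_iff)
  \<comment> \<open>The point \<open>x\<close> plays the part of the fiber projection, so it is
    first recorded as an arrow to which \<open>is_fiber_wreath_iff\<close> applies.\<close>
  have xarr: "is_wreath_arr (One \<Phi>) (\<lambda>i \<in> Points \<Phi> (One \<Phi>). One \<Psi>) i (\<lambda>_ \<in> Points \<Phi> (One \<Phi>). y) I M"
  proof -
    have "x \<in> Points W (I, M)" using x X by (auto simp: Points_wreath)
    then show ?thesis by (simp add: x wreath_point_def Points_def[of W] Hom_wreath)
  qed
  have fiber: "is_fiber W ((I, M), (\<eta>, \<omega>), (T, TM)) (wreath_point T TM t t') x \<longleftrightarrow>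
      is_fiber \<Phi> \<eta> t i \<and> is_fiber \<Psi> (\<omega> i) t' y" if "is_wreath_arr I M \<eta> \<omega> T TM" for \<eta> \<omega>
    using is_fiber_wreath_iff[OF that xarr t(2), of t'] t x
    by (simp add: TMt wreath_point_def P.Points_iff)
  obtain \<chi> where \<chi>: "\<chi> \<in> Hom \<Phi> I T" "is_fiber \<Phi> \<chi> t i"
    and \<chi>_unique: "\<And>f. f \<in> Hom \<Phi> I T \<Longrightarrow> is_fiber \<Phi> f t i \<Longrightarrow> f = \<chi>"
    using T IM(1) x(2) unfolding P.point_classifier_iff by blast
  obtain \<psi> where \<psi>: "\<psi> \<in> Hom \<Psi> (M i) T'" "is_fiber \<Psi> \<psi> t' y"
    and \<psi>_unique: "\<And>f. f \<in> Hom \<Psi> (M i) T' \<Longrightarrow> is_fiber \<Psi> f t' y \<Longrightarrow> f = \<psi>"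
    using T' IM(3)[OF x(2)] x(3) unfolding Q.point_classifier_iff by blast
  \<comment> \<open>The fiber over \<open>t\<close> is \<open>i\<close> itself, whose domain
    \<open>One \<Phi>\<close> has a single point.\<close>
  have \<chi>_eq: "\<chi> \<cdot>\<^bsub>\<Phi>\<^esub> j = t \<longleftrightarrow> j = i" if j: "j \<in> Points \<Phi> I" for j
  proof
    assume "\<chi> \<cdot>\<^bsub>\<Phi>\<^esub> j = t"
    then have "\<exists>!k. k \<in> Points \<Phi> (Dom \<Phi> i) \<and> i \<cdot>\<^bsub>\<Phi>\<^esub> k = j"
      using P.fiber_point_lift[OF \<chi>(2)] j \<chi>(1) by (simp add: Hom_def)
    then show "j = i" using x(2) by (auto simp: P.Points_iff[of i])
  next
    assume "j = i"
    then show "\<chi> \<cdot>\<^bsub>\<Phi>\<^esub> j = t"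
      using P.is_fiberD(4,5)[OF \<chi>(2)] x(2) by (simp add: P.Points_iff)
  qed
  have \<chi>_point: "\<chi> \<cdot>\<^bsub>\<Phi>\<^esub> j \<in> Points \<Phi> T" if "j \<in> Points \<Phi> I" for j
    using that \<chi>(1) by (simp add: P.Points_iff Hom_def)
  define \<omega> where "\<omega> = (\<lambda>j \<in> Points \<Phi> I. if j = i then \<psi> else bang \<Psi> (M j))"
  have \<omega>: "is_wreath_arr I M \<chi> \<omega> T TM"
    using TM X(2) \<chi>(1) \<psi>(1) IM(3) Q.bang_Hom \<chi>_eq \<chi>_point
    by (auto simp: is_wreath_arr_def Obj_wreath \<omega>_def TM_def PiE_iff)
  have "f = ((I, M), (\<chi>, \<omega>), (T, TM))"
    if f: "f \<in> Hom W (I, M) (T, TM)" "is_fiber W f (wreath_point T TM t t') x" for f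
  proof -
    obtain \<eta> \<theta> where fe: "f = ((I, M), (\<eta>, \<theta>), (T, TM))" "is_wreath_arr I M \<eta> \<theta> T TM"
      using f(1) by (auto simp: Hom_wreath)
    then have fib: "is_fiber \<Phi> \<eta> t i" "is_fiber \<Psi> (\<theta> i) t' y" using f(2) fiber by auto
    have \<eta>: "\<eta> = \<chi>" using fe(2) fib(1) by (auto simp: is_wreath_arr_def intro: \<chi>_unique)
    have "\<omega> j = \<theta> j" if j: "j \<in> Points \<Phi> I" for j
    proof (cases "j = i")
      case True
      then show ?thesis
        using is_wreath_arr_point(1)[OF fe(2) j] fib(2) \<psi>_unique[of "\<theta> i"] \<chi>_eq[OF j] \<chi>_point[OF j] j
        by (simp add: \<omega>_def \<eta> TMt)
    next
      case False
      then have "TM (\<chi> \<cdot>\<^bsub>\<Phi>\<^esub> j) = One \<Psi>" using \<chi>_eq[OF j] \<chi>_point[OF j] by (simp add: TM_def)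
      then show ?thesis
        using False is_wreath_arr_point(3-5)[OF fe(2) j] j Q.bang_unique[of "\<theta> j" "M j"]
        by (simp add: \<omega>_def \<eta>)
    qed
    then have "\<omega> = \<theta>"
      using is_wreath_arrD(6)[OF \<omega>] is_wreath_arrD(6)[OF fe(2)] by (auto intro: extensionalityI)
    then show ?thesis using fe(1) \<eta> by simp
  qed
  moreover have "((I, M), (\<chi>, \<omega>), (T, TM)) \<in> Hom W (I, M) (T, TM)"
    "is_fiber W ((I, M), (\<chi>, \<omega>), (T, TM)) (wreath_point T TM t t') x"
    using \<omega> fiber[OF \<omega>] \<chi> \<psi> x(2) by (auto simp: Hom_wreath \<omega>_def)
  ultimately show "\<exists>!f. f \<in> Hom W X (T, TM) \<and> is_fiber W f (wreath_point T TM t t') x"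
    unfolding X(1) by blast
qed

text \<open>A map \<open>(h0, \<theta>)\<close> on the fiber of \<open>f\<close> is extended in
  \<Phi> by \<kappa>, and then in \<Psi> separately at each point \<open>k\<close> of that fiber,
  where \<open>\<theta> k\<close> is a map into \<open>M (h0 \<cdot> k)\<close>. The cofree data for
  an index \<open>i\<close> are thus used at every \<open>k\<close> with
  \<open>h0 \<cdot> k = i\<close>.\<close>

lemma cofree_over_wreath:
  assumes t: "t \<in> Points \<Phi> T" and t': "t' \<in> Points \<Psi> T'"
  defines "TM \<equiv> \<lambda>s \<in> Points \<Phi> T. if s = t then T' else One \<Psi>"
  assumes IM: "(I, M) \<in> wreath_obj \<Psi> \<Phi>"
    and cof: "cofree_over \<Phi> T t I \<gamma> p e"
    and cof': "\<And>i. i \<in> Points \<Phi> I \<Longrightarrow> cofree_over \<Psi> T' t' (M i) (\<gamma>' i) (p' i) (e' i)"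
  shows "\<exists>\<Gamma> P E. cofree_over W (T, TM) (wreath_point T TM t t') (I, M) \<Gamma> P E"
proof -
  have TMt: "TM t = T'" using t by (simp add: TM_def)
  have T_Obj: "T \<in> Obj \<Phi>" "T' \<in> Obj \<Psi>"
    using t t' by (auto simp: P.Points_iff Q.Points_iff)
  then have TM: "(T, TM) \<in> wreath_obj \<Psi> \<Phi>" by (auto simp: TM_def Obj_wreath)
  have \<gamma>: "\<gamma> \<in> Arr \<Phi>" "Cod \<Phi> \<gamma> = T" "is_fiber \<Phi> \<gamma> t p" "e \<in> Hom \<Phi> (Dom \<Phi> p) I"
    and univ: "\<And>f q h. f \<in> Arr \<Phi> \<Longrightarrow> Cod \<Phi> f = T \<Longrightarrow> is_fiber \<Phi> f t q \<Longrightarrow> h \<in> Hom \<Phi> (Dom \<Phi> q) I \<Longrightarrow>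
        \<exists>!k. k \<in> Hom \<Phi> (Dom \<Phi> f) (Dom \<Phi> \<gamma>) \<and> \<gamma> \<cdot>\<^bsub>\<Phi>\<^esub> k = f \<and>
           (\<exists>u \<in> Hom \<Phi> (Dom \<Phi> q) (Dom \<Phi> p). p \<cdot>\<^bsub>\<Phi>\<^esub> u = k \<cdot>\<^bsub>\<Phi>\<^esub> q \<and> e \<cdot>\<^bsub>\<Phi>\<^esub> u = h)"
    using cof by (simp_all add: cofree_over_def)
  have \<gamma>': "\<gamma>' i \<in> Arr \<Psi>" "Cod \<Psi> (\<gamma>' i) = T'" "is_fiber \<Psi> (\<gamma>' i) t' (p' i)"
      "e' i \<in> Hom \<Psi> (Dom \<Psi> (p' i)) (M i)"
    if "i \<in> Points \<Phi> I" for i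
    using cof'[OF that] by (simp_all add: cofree_over_def)
  have univ': "\<exists>!k. k \<in> Hom \<Psi> (Dom \<Psi> f) (Dom \<Psi> (\<gamma>' i)) \<and> \<gamma>' i \<cdot>\<^bsub>\<Psi>\<^esub> k = f \<and>
       (\<exists>u \<in> Hom \<Psi> (Dom \<Psi> q) (Dom \<Psi> (p' i)). p' i \<cdot>\<^bsub>\<Psi>\<^esub> u = k \<cdot>\<^bsub>\<Psi>\<^esub> q \<and> e' i \<cdot>\<^bsub>\<Psi>\<^esub> u = h)"
    if "i \<in> Points \<Phi> I" "f \<in> Arr \<Psi>" "Cod \<Psi> f = T'" "is_fiber \<Psi> f t' q" "h \<in> Hom \<Psi> (Dom \<Psi> q) (M i)"
    for i f q h
    using cof'[OF that(1)] that(2-) by (simp add: cofree_over_def)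
  define D F where "D = Dom \<Phi> \<gamma>" and "F = Dom \<Phi> p"
  note pD = P.is_fiberD[OF \<gamma>(3)] and pD' = Q.is_fiberD[OF \<gamma>'(3)]
  have eD: "e \<in> Arr \<Phi>" "Dom \<Phi> e = F" "Cod \<Phi> e = I" using \<gamma>(4) by (auto simp: Hom_def F_def)
  \<comment> \<open>\<open>hat d\<close> is the point of the fiber \<open>F\<close> that \<open>p\<close> sends to \<open>d\<close>; it is junk unless \<open>d\<close> lies over \<open>t\<close>.\<close>
  define hat where "hat d = (THE k. k \<in> Points \<Phi> F \<and> p \<cdot>\<^bsub>\<Phi>\<^esub> k = d)" for d
  have hat_p: "hat (p \<cdot>\<^bsub>\<Phi>\<^esub> k) = k" and \<gamma>pk: "\<gamma> \<cdot>\<^bsub>\<Phi>\<^esub> p \<cdot>\<^bsub>\<Phi>\<^esub> k = t" and pk: "p \<cdot>\<^bsub>\<Phi>\<^esub> k \<in> Points \<Phi> D"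
    and ek: "e \<cdot>\<^bsub>\<Phi>\<^esub> k \<in> Points \<Phi> I"
    if k: "k \<in> Points \<Phi> F" for k
  proof -
    show 1: "\<gamma> \<cdot>\<^bsub>\<Phi>\<^esub> p \<cdot>\<^bsub>\<Phi>\<^esub> k = t" "p \<cdot>\<^bsub>\<Phi>\<^esub> k \<in> Points \<Phi> D"
      using P.fiber_point[OF \<gamma>(3)] k by (auto simp: F_def D_def)
    show "hat (p \<cdot>\<^bsub>\<Phi>\<^esub> k) = k"
      unfolding hat_def
      by (rule the1_equality) (use P.fiber_point_lift[OF \<gamma>(3), of "p \<cdot>\<^bsub>\<Phi>\<^esub> k"] 1 k in \<open>simp_all add: F_def D_def\<close>)
    show "e \<cdot>\<^bsub>\<Phi>\<^esub> k \<in> Points \<Phi> I" using k eD by (simp add: P.Points_iff)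
  qed
  have hat: "hat d \<in> Points \<Phi> F" "p \<cdot>\<^bsub>\<Phi>\<^esub> hat d = d" if "d \<in> Points \<Phi> D" "\<gamma> \<cdot>\<^bsub>\<Phi>\<^esub> d = t" for d
    using theI'[OF P.fiber_point_lift[OF \<gamma>(3), of d]] that by (auto simp: hat_def F_def D_def)
  \<comment> \<open>Over \<open>t\<close>, the point \<open>e \<cdot> hat d\<close> tells to which
    member of \<open>M\<close> the value belongs. Elsewhere the value \<open>One \<Psi>\<close>,
    which \<open>TM\<close> takes there too, makes every component into \<open>R d\<close>
    unique.\<close>
  define R where "R = (\<lambda>d \<in> Points \<Phi> D. if \<gamma> \<cdot>\<^bsub>\<Phi>\<^esub> d = t then Dom \<Psi> (\<gamma>' (e \<cdot>\<^bsub>\<Phi>\<^esub> hat d)) else One \<Psi>)"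
  define g where "g = (\<lambda>d \<in> Points \<Phi> D. if \<gamma> \<cdot>\<^bsub>\<Phi>\<^esub> d = t then \<gamma>' (e \<cdot>\<^bsub>\<Phi>\<^esub> hat d) else bang \<Psi> (One \<Psi>))"
  \<comment> \<open>\<open>L\<close>, \<open>r\<close> and \<epsilon> are the \<Psi>-data reindexed
    along \<open>e\<close>, without cases since all points of \<open>F\<close> lie over
    \<open>t\<close>.\<close>
  define L where "L = (\<lambda>k \<in> Points \<Phi> F. Dom \<Psi> (p' (e \<cdot>\<^bsub>\<Phi>\<^esub> k)))"
  define r where "r = (\<lambda>k \<in> Points \<Phi> F. p' (e \<cdot>\<^bsub>\<Phi>\<^esub> k))"
  define \<epsilon> where "\<epsilon> = (\<lambda>k \<in> Points \<Phi> F. e' (e \<cdot>\<^bsub>\<Phi>\<^esub> k))"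
  let ?T = "(T, TM)" and ?t = "wreath_point T TM t t'"
  have obj: "D \<in> Obj \<Phi>" "F \<in> Obj \<Phi>" using \<gamma>(1) pD by (auto simp: D_def F_def)
  have R_Obj: "R \<in> Points \<Phi> D \<rightarrow>\<^sub>E Obj \<Psi>"
    using \<gamma>'(1) ek hat by (auto simp: R_def)
  have L_Obj: "L \<in> Points \<Phi> F \<rightarrow>\<^sub>E Obj \<Psi>" using pD'(2) ek by (auto simp: L_def)
  have \<gamma>_Points: "\<gamma> \<cdot>\<^bsub>\<Phi>\<^esub> d \<in> Points \<Phi> T" if "d \<in> Points \<Phi> D" for d
    using that \<gamma> by (simp add: P.Points_iff D_def)
  have g: "is_wreath_arr D R \<gamma> g T TM"
  proof -
    have "g d \<in> Hom \<Psi> (R d) (TM (\<gamma> \<cdot>\<^bsub>\<Phi>\<^esub> d))" if d: "d \<in> Points \<Phi> D" for d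
      using d \<gamma>'(1,2) ek hat \<gamma>_Points[OF d] by (auto simp: g_def R_def TM_def Hom_def)
    then show ?thesis
      using obj R_Obj TM \<gamma>(1,2) by (auto simp: is_wreath_arr_def Obj_wreath Hom_def D_def g_def)
  qed
  have Rpk: "R (p \<cdot>\<^bsub>\<Phi>\<^esub> k) = Dom \<Psi> (\<gamma>' (e \<cdot>\<^bsub>\<Phi>\<^esub> k))" and gpk: "g (p \<cdot>\<^bsub>\<Phi>\<^esub> k) = \<gamma>' (e \<cdot>\<^bsub>\<Phi>\<^esub> k)"
    if "k \<in> Points \<Phi> F" for k
    using pk[OF that] \<gamma>pk[OF that] hat_p[OF that] by (simp_all add: R_def g_def)
  have r: "is_wreath_arr F L p r D R"
    using obj L_Obj R_Obj pD pD'(2,3) ek Rpk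
    by (auto simp: is_wreath_arr_def Hom_def F_def[symmetric] D_def[symmetric] r_def L_def)
  have \<epsilon>: "is_wreath_arr F L e \<epsilon> I M"
    using obj L_Obj IM eD \<gamma>'(4) ek by (auto simp: is_wreath_arr_def Obj_wreath Hom_def \<epsilon>_def L_def)
  have fib: "is_fiber W ((D, R), (\<gamma>, g), ?T) ?t ((F, L), (p, r), (D, R))"
    by (rule is_fiber_wreathI[OF g r t])
      (use t' TMt \<gamma>(3) \<gamma>'(3) ek gpk in \<open>auto simp: r_def\<close>)
  have "\<exists>!k. k \<in> Hom W (Dom W f) (D, R) \<and> ((D, R), (\<gamma>, g), ?T) \<cdot>\<^bsub>W\<^esub> k = f \<and>
      (\<exists>u \<in> Hom W (Dom W q) (F, L). ((F, L), (p, r), (D, R)) \<cdot>\<^bsub>W\<^esub> u = k \<cdot>\<^bsub>W\<^esub> q \<and>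
         ((F, L), (e, \<epsilon>), (I, M)) \<cdot>\<^bsub>W\<^esub> u = h)"
    if f: "f \<in> Arr W" "Cod W f = ?T" and q: "is_fiber W f ?t q" and h: "h \<in> Hom W (Dom W q) (I, M)"
    for f q h
  proof -
    obtain J N \<eta> \<omega> where fe: "f = ((J, N), (\<eta>, \<omega>), ?T)" and \<omega>: "is_wreath_arr J N \<eta> \<omega> T TM"
      using f by (auto elim!: wreath_ArrE)
    have "q \<in> Arr W" "Cod W q = (J, N)" using W.is_fiberD(2,3)[OF q] by (auto simp: fe)
    then obtain K Q q0 \<rho> where qe: "q = ((K, Q), (q0, \<rho>), (J, N))" and \<rho>: "is_wreath_arr K Q q0 \<rho> J N"
      by (auto elim!: wreath_ArrE)
    obtain h0 \<theta> where he: "h = ((K, Q), (h0, \<theta>), (I, M))" and \<theta>: "is_wreath_arr K Q h0 \<theta> I M"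
      using h by (auto simp: qe Hom_wreath)
    have q0: "is_fiber \<Phi> \<eta> t q0"
      and \<rho>_fib: "\<And>k. k \<in> Points \<Phi> K \<Longrightarrow> is_fiber \<Psi> (\<omega> (q0 \<cdot>\<^bsub>\<Phi>\<^esub> k)) t' (\<rho> k)"
      using q is_fiber_wreath_iff[OF \<omega> \<rho> t] t' by (auto simp: fe qe TMt)
    note \<omega>D = is_wreath_arrD[OF \<omega>] and \<rho>D = is_wreath_arrD[OF \<rho>] and \<theta>D = is_wreath_arrD[OF \<theta>]
    \<comment> \<open>The witness \<open>u\<close> is named, and uniqueness is stated for an
      arbitrary witness \<open>v\<close>, so that it can be matched with the base of any competing
      arrow.\<close>
    obtain \<kappa> u where \<kappa>: "\<kappa> \<in> Arr \<Phi>" "Dom \<Phi> \<kappa> = J" "Cod \<Phi> \<kappa> = D" "\<gamma> \<cdot>\<^bsub>\<Phi>\<^esub> \<kappa> = \<eta>"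
      and u: "u \<in> Arr \<Phi>" "Dom \<Phi> u = K" "Cod \<Phi> u = F" "p \<cdot>\<^bsub>\<Phi>\<^esub> u = \<kappa> \<cdot>\<^bsub>\<Phi>\<^esub> q0" "e \<cdot>\<^bsub>\<Phi>\<^esub> u = h0"
      and \<kappa>_unique: "\<And>k v. k \<in> Hom \<Phi> J D \<Longrightarrow> \<gamma> \<cdot>\<^bsub>\<Phi>\<^esub> k = \<eta> \<Longrightarrow> v \<in> Hom \<Phi> K F \<Longrightarrow>
          p \<cdot>\<^bsub>\<Phi>\<^esub> v = k \<cdot>\<^bsub>\<Phi>\<^esub> q0 \<Longrightarrow> e \<cdot>\<^bsub>\<Phi>\<^esub> v = h0 \<Longrightarrow> k = \<kappa>"
    proof -
      have "\<exists>!k. k \<in> Hom \<Phi> J D \<and> \<gamma> \<cdot>\<^bsub>\<Phi>\<^esub> k = \<eta> \<and>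
          (\<exists>u \<in> Hom \<Phi> K F. p \<cdot>\<^bsub>\<Phi>\<^esub> u = k \<cdot>\<^bsub>\<Phi>\<^esub> q0 \<and> e \<cdot>\<^bsub>\<Phi>\<^esub> u = h0)"
        using univ[of \<eta> q0 h0] \<omega>D \<rho>D \<theta>D q0 by (simp add: D_def F_def Hom_def)
      then show ?thesis using that unfolding Hom_def by blast
    qed
    have qk: "q0 \<cdot>\<^bsub>\<Phi>\<^esub> k \<in> Points \<Phi> J" "\<eta> \<cdot>\<^bsub>\<Phi>\<^esub> q0 \<cdot>\<^bsub>\<Phi>\<^esub> k = t" if "k \<in> Points \<Phi> K" for k
      using P.fiber_point[OF q0] that \<rho>D \<omega>D by auto
    have uk: "u \<cdot>\<^bsub>\<Phi>\<^esub> k \<in> Points \<Phi> F" if "k \<in> Points \<Phi> K" for k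
      using that u by (simp add: P.Points_iff)
    have h0k: "h0 \<cdot>\<^bsub>\<Phi>\<^esub> k \<in> Points \<Phi> I" "e \<cdot>\<^bsub>\<Phi>\<^esub> u \<cdot>\<^bsub>\<Phi>\<^esub> k = h0 \<cdot>\<^bsub>\<Phi>\<^esub> k" if "k \<in> Points \<Phi> K" for k
    proof -
      have "e \<cdot>\<^bsub>\<Phi>\<^esub> u \<cdot>\<^bsub>\<Phi>\<^esub> k = (e \<cdot>\<^bsub>\<Phi>\<^esub> u) \<cdot>\<^bsub>\<Phi>\<^esub> k" using that u(1-3) eD by (simp add: P.Points_iff)
      then show "e \<cdot>\<^bsub>\<Phi>\<^esub> u \<cdot>\<^bsub>\<Phi>\<^esub> k = h0 \<cdot>\<^bsub>\<Phi>\<^esub> k" using u(5) by simp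
      then show "h0 \<cdot>\<^bsub>\<Phi>\<^esub> k \<in> Points \<Phi> I" using ek[OF uk[OF that]] by simp
    qed
    have \<kappa>qk: "\<kappa> \<cdot>\<^bsub>\<Phi>\<^esub> q0 \<cdot>\<^bsub>\<Phi>\<^esub> k = p \<cdot>\<^bsub>\<Phi>\<^esub> u \<cdot>\<^bsub>\<Phi>\<^esub> k" if "k \<in> Points \<Phi> K" for k
    proof -
      have "\<kappa> \<cdot>\<^bsub>\<Phi>\<^esub> q0 \<cdot>\<^bsub>\<Phi>\<^esub> k = (\<kappa> \<cdot>\<^bsub>\<Phi>\<^esub> q0) \<cdot>\<^bsub>\<Phi>\<^esub> k" using that \<kappa>(1-3) \<rho>D by (simp add: P.Points_iff)
      also have "\<dots> = p \<cdot>\<^bsub>\<Phi>\<^esub> u \<cdot>\<^bsub>\<Phi>\<^esub> k"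
        unfolding u(4)[symmetric] using that u(1-3) pD by (simp add: P.Points_iff F_def)
      finally show ?thesis .
    qed
    have \<kappa>j: "\<kappa> \<cdot>\<^bsub>\<Phi>\<^esub> j \<in> Points \<Phi> D" "\<gamma> \<cdot>\<^bsub>\<Phi>\<^esub> \<kappa> \<cdot>\<^bsub>\<Phi>\<^esub> j = \<eta> \<cdot>\<^bsub>\<Phi>\<^esub> j" if "j \<in> Points \<Phi> J" for j
    proof -
      show "\<kappa> \<cdot>\<^bsub>\<Phi>\<^esub> j \<in> Points \<Phi> D" using that \<kappa> by (simp add: P.Points_iff)
      have "\<gamma> \<cdot>\<^bsub>\<Phi>\<^esub> \<kappa> \<cdot>\<^bsub>\<Phi>\<^esub> j = (\<gamma> \<cdot>\<^bsub>\<Phi>\<^esub> \<kappa>) \<cdot>\<^bsub>\<Phi>\<^esub> j"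
        using that \<kappa>(1-3) \<gamma> by (simp add: P.Points_iff D_def)
      then show "\<gamma> \<cdot>\<^bsub>\<Phi>\<^esub> \<kappa> \<cdot>\<^bsub>\<Phi>\<^esub> j = \<eta> \<cdot>\<^bsub>\<Phi>\<^esub> j" using \<kappa>(4) by simp
    qed
    \<comment> \<open>The points \<open>\<kappa> \<cdot> q0 \<cdot> k\<close> and
      \<open>p \<cdot> u \<cdot> k\<close> coincide and \<open>e \<cdot> u = h0\<close>, so every
      constructed family takes its value for the index \<open>h0 \<cdot> k\<close>.\<close>
    have over: "R (\<kappa> \<cdot>\<^bsub>\<Phi>\<^esub> q0 \<cdot>\<^bsub>\<Phi>\<^esub> k) = Dom \<Psi> (\<gamma>' (h0 \<cdot>\<^bsub>\<Phi>\<^esub> k))" "g (\<kappa> \<cdot>\<^bsub>\<Phi>\<^esub> q0 \<cdot>\<^bsub>\<Phi>\<^esub> k) = \<gamma>' (h0 \<cdot>\<^bsub>\<Phi>\<^esub> k)"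
      "r (u \<cdot>\<^bsub>\<Phi>\<^esub> k) = p' (h0 \<cdot>\<^bsub>\<Phi>\<^esub> k)" "L (u \<cdot>\<^bsub>\<Phi>\<^esub> k) = Dom \<Psi> (p' (h0 \<cdot>\<^bsub>\<Phi>\<^esub> k))"
      "\<epsilon> (u \<cdot>\<^bsub>\<Phi>\<^esub> k) = e' (h0 \<cdot>\<^bsub>\<Phi>\<^esub> k)" if "k \<in> Points \<Phi> K" for k
      using Rpk[OF uk[OF that]] gpk[OF uk[OF that]] uk[OF that] h0k[OF that] \<kappa>qk[OF that]
      by (simp_all add: r_def L_def \<epsilon>_def)
    have off: "R (\<kappa> \<cdot>\<^bsub>\<Phi>\<^esub> j) = One \<Psi>" "TM (\<eta> \<cdot>\<^bsub>\<Phi>\<^esub> j) = One \<Psi>" if "j \<in> Points \<Phi> J" "\<eta> \<cdot>\<^bsub>\<Phi>\<^esub> j \<noteq> t" for j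
      using \<kappa>j[OF that(1)] is_wreath_arr_point(2)[OF \<omega> that(1)] that(2) by (simp_all add: R_def TM_def)
    \<comment> \<open>The extension problem in \<Psi> at \<open>k\<close>: \<open>\<theta> k\<close>
      is defined on the fiber \<open>\<rho> k\<close> of \<open>\<omega> (q0 \<cdot> k)\<close>,
      \<open>n\<close> is the extension and \<open>m\<close> the map that it induces between
      fibers.\<close>
    let ?lift = "\<lambda>k n m. n \<in> Hom \<Psi> (N (q0 \<cdot>\<^bsub>\<Phi>\<^esub> k)) (Dom \<Psi> (\<gamma>' (h0 \<cdot>\<^bsub>\<Phi>\<^esub> k))) \<and>
        \<gamma>' (h0 \<cdot>\<^bsub>\<Phi>\<^esub> k) \<cdot>\<^bsub>\<Psi>\<^esub> n = \<omega> (q0 \<cdot>\<^bsub>\<Phi>\<^esub> k) \<and> m \<in> Hom \<Psi> (Q k) (Dom \<Psi> (p' (h0 \<cdot>\<^bsub>\<Phi>\<^esub> k))) \<and>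
        p' (h0 \<cdot>\<^bsub>\<Phi>\<^esub> k) \<cdot>\<^bsub>\<Psi>\<^esub> m = n \<cdot>\<^bsub>\<Psi>\<^esub> \<rho> k \<and> e' (h0 \<cdot>\<^bsub>\<Phi>\<^esub> k) \<cdot>\<^bsub>\<Psi>\<^esub> m = \<theta> k"
    have lift: "\<exists>!n. \<exists>m. ?lift k n m" if k: "k \<in> Points \<Phi> K" for k
    proof -
      have "Cod \<Psi> (\<omega> (q0 \<cdot>\<^bsub>\<Phi>\<^esub> k)) = T'" "Dom \<Psi> (\<omega> (q0 \<cdot>\<^bsub>\<Phi>\<^esub> k)) = N (q0 \<cdot>\<^bsub>\<Phi>\<^esub> k)" "\<omega> (q0 \<cdot>\<^bsub>\<Phi>\<^esub> k) \<in> Arr \<Psi>"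
        "Dom \<Psi> (\<rho> k) = Q k" "\<theta> k \<in> Hom \<Psi> (Q k) (M (h0 \<cdot>\<^bsub>\<Phi>\<^esub> k))"
        using is_wreath_arr_point[OF \<omega> qk(1)[OF k]] qk(2)[OF k] TMt is_wreath_arr_point(4)[OF \<rho> k]
          is_wreath_arr_point(1)[OF \<theta> k] by simp_all
      then show ?thesis
        using univ'[OF h0k(1)[OF k] _ _ \<rho>_fib[OF k], of "\<theta> k"] by (simp add: Bex_def conj_assoc)
    qed
    then obtain n m where nm: "\<And>k. k \<in> Points \<Phi> K \<Longrightarrow> ?lift k (n k) (m k)"
      by metis
    have n_unique: "n' = n k" if "k \<in> Points \<Phi> K" "?lift k n' m'" for k n' m'
      using lift[OF that(1)] nm[OF that(1)] that(2) by blast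
    \<comment> \<open>Inverse of \<open>q0\<close> on the points over \<open>t\<close>, as
      \<open>hat\<close> is for \<open>p\<close>.\<close>
    define c where "c j = (THE k. k \<in> Points \<Phi> K \<and> q0 \<cdot>\<^bsub>\<Phi>\<^esub> k = j)" for j
    have c_ex: "\<exists>!k. k \<in> Points \<Phi> K \<and> q0 \<cdot>\<^bsub>\<Phi>\<^esub> k = j" if "j \<in> Points \<Phi> J" "\<eta> \<cdot>\<^bsub>\<Phi>\<^esub> j = t" for j
      using P.fiber_point_lift[OF q0, of j] that \<rho>D \<omega>D by simp
    have c: "c j \<in> Points \<Phi> K" "q0 \<cdot>\<^bsub>\<Phi>\<^esub> c j = j" if "j \<in> Points \<Phi> J" "\<eta> \<cdot>\<^bsub>\<Phi>\<^esub> j = t" for j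
      using theI'[OF c_ex[OF that]] by (auto simp: c_def)
    have c_q: "c (q0 \<cdot>\<^bsub>\<Phi>\<^esub> k) = k" if "k \<in> Points \<Phi> K" for k
      unfolding c_def by (rule the1_equality[OF c_ex[OF qk[OF that]]]) (use that in simp)
    \<comment> \<open>Off the fiber the target \<open>R (\<kappa> \<cdot> j)\<close> is
      \<open>One \<Psi>\<close>, which leaves only \<open>bang\<close>.\<close>
    define \<nu> where "\<nu> = (\<lambda>j \<in> Points \<Phi> J. if \<eta> \<cdot>\<^bsub>\<Phi>\<^esub> j = t then n (c j) else bang \<Psi> (N j))"
    have \<nu>q: "\<nu> (q0 \<cdot>\<^bsub>\<Phi>\<^esub> k) = n k" if "k \<in> Points \<Phi> K" for k
      using qk[OF that] c_q[OF that] by (simp add: \<nu>_def)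
    have \<nu>_Hom: "\<nu> j \<in> Hom \<Psi> (N j) (R (\<kappa> \<cdot>\<^bsub>\<Phi>\<^esub> j))" if j: "j \<in> Points \<Phi> J" for j
    proof (cases "\<eta> \<cdot>\<^bsub>\<Phi>\<^esub> j = t")
      case True
      then show ?thesis using nm[OF c(1)[OF j True]] over(1)[OF c(1)[OF j True]] c(2)[OF j True] j
        by (simp add: \<nu>_def)
    next
      case False
      then show ?thesis using j off(1)[OF j False] Q.bang_Hom \<omega>D(10)[OF j] by (simp add: \<nu>_def)
    qed
    have \<nu>: "is_wreath_arr J N \<kappa> \<nu> D R"
      using \<nu>_Hom \<omega> R_Obj obj(1) \<kappa> by (auto simp: is_wreath_arr_def Hom_def \<nu>_def)
    have \<mu>: "is_wreath_arr K Q u (restrict m (Points \<Phi> K)) F L"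
      using nm over(4) \<rho> L_Obj obj(2) u by (auto simp: is_wreath_arr_def Hom_def)
    have g\<nu>: "g (\<kappa> \<cdot>\<^bsub>\<Phi>\<^esub> j) \<cdot>\<^bsub>\<Psi>\<^esub> \<nu> j = \<omega> j" if j: "j \<in> Points \<Phi> J" for j
    proof (cases "\<eta> \<cdot>\<^bsub>\<Phi>\<^esub> j = t")
      case True
      then show ?thesis using nm[OF c(1)[OF j True]] over(2)[OF c(1)[OF j True]] c(2)[OF j True] j
        by (simp add: \<nu>_def)
    next
      \<comment> \<open>Both sides are arrows from \<open>N j\<close> to
        \<open>TM (\<eta> \<cdot> j)\<close>, which is terminal here.\<close>
      case False
      note G = is_wreath_arr_point(3-5)[OF g \<kappa>j(1)[OF j]] and O = is_wreath_arr_point(3-5)[OF \<omega> j]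
        and U = \<nu>_Hom[OF j]
      have "g (\<kappa> \<cdot>\<^bsub>\<Phi>\<^esub> j) \<cdot>\<^bsub>\<Psi>\<^esub> \<nu> j = bang \<Psi> (N j)"
        by (rule Q.bang_unique) (use G U \<kappa>j(2)[OF j] off(2)[OF j False] in \<open>simp_all add: Hom_def\<close>)
      also have "\<dots> = \<omega> j"
        using O off(2)[OF j False] by (intro Q.bang_unique[symmetric]) simp_all
      finally show ?thesis .
    qed
    let ?k = "((J, N), (\<kappa>, \<nu>), (D, R))" and ?u = "((K, Q), (u, restrict m (Points \<Phi> K)), (F, L))"
    have k1: "((D, R), (\<gamma>, g), ?T) \<cdot>\<^bsub>W\<^esub> ?k = f"
      using \<kappa>(4) g\<nu> \<omega>D(6) by (simp add: fe restrict_eq_iff)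
    have k2: "((F, L), (p, r), (D, R)) \<cdot>\<^bsub>W\<^esub> ?u = ?k \<cdot>\<^bsub>W\<^esub> q"
      using u(4) over(3) nm \<nu>q by (auto simp: qe intro!: restrict_ext)
    have k3: "((F, L), (e, \<epsilon>), (I, M)) \<cdot>\<^bsub>W\<^esub> ?u = h"
      using u(5) over(5) nm \<theta>D(6) by (simp add: he restrict_eq_iff)
    show ?thesis
    proof (rule ex1I[of _ ?k], intro conjI bexI[of _ ?u] k1 k2 k3)
      show "?k \<in> Hom W (Dom W f) (D, R)" "?u \<in> Hom W (Dom W q) (F, L)"
        using \<nu> \<mu> by (simp_all add: fe qe Hom_wreath)
    next
      fix k' assume k': "k' \<in> Hom W (Dom W f) (D, R) \<and> ((D, R), (\<gamma>, g), ?T) \<cdot>\<^bsub>W\<^esub> k' = f \<and>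
        (\<exists>u \<in> Hom W (Dom W q) (F, L). ((F, L), (p, r), (D, R)) \<cdot>\<^bsub>W\<^esub> u = k' \<cdot>\<^bsub>W\<^esub> q \<and>
         ((F, L), (e, \<epsilon>), (I, M)) \<cdot>\<^bsub>W\<^esub> u = h)"
      then obtain u' where u': "u' \<in> Hom W (Dom W q) (F, L)"
          "((F, L), (p, r), (D, R)) \<cdot>\<^bsub>W\<^esub> u' = k' \<cdot>\<^bsub>W\<^esub> q" "((F, L), (e, \<epsilon>), (I, M)) \<cdot>\<^bsub>W\<^esub> u' = h"
        by blast
      obtain \<kappa>1 \<nu>1 where k'e: "k' = ((J, N), (\<kappa>1, \<nu>1), (D, R))" and \<nu>1: "is_wreath_arr J N \<kappa>1 \<nu>1 D R"
        using k' by (auto simp: fe Hom_wreath)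
      obtain u1 \<mu>1 where u'e: "u' = ((K, Q), (u1, \<mu>1), (F, L))" and \<mu>1: "is_wreath_arr K Q u1 \<mu>1 F L"
        using u'(1) by (auto simp: qe Hom_wreath)
      have e1: "\<gamma> \<cdot>\<^bsub>\<Phi>\<^esub> \<kappa>1 = \<eta>" and e2: "(\<lambda>j \<in> Points \<Phi> J. g (\<kappa>1 \<cdot>\<^bsub>\<Phi>\<^esub> j) \<cdot>\<^bsub>\<Psi>\<^esub> \<nu>1 j) = \<omega>"
        using k' by (simp_all add: fe k'e)
      have e3: "p \<cdot>\<^bsub>\<Phi>\<^esub> u1 = \<kappa>1 \<cdot>\<^bsub>\<Phi>\<^esub> q0"
        and e4: "(\<lambda>k \<in> Points \<Phi> K. r (u1 \<cdot>\<^bsub>\<Phi>\<^esub> k) \<cdot>\<^bsub>\<Psi>\<^esub> \<mu>1 k) =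
          (\<lambda>k \<in> Points \<Phi> K. \<nu>1 (q0 \<cdot>\<^bsub>\<Phi>\<^esub> k) \<cdot>\<^bsub>\<Psi>\<^esub> \<rho> k)"
        using u'(2) by (simp_all add: k'e u'e qe)
      have e5: "e \<cdot>\<^bsub>\<Phi>\<^esub> u1 = h0" and e6: "(\<lambda>k \<in> Points \<Phi> K. \<epsilon> (u1 \<cdot>\<^bsub>\<Phi>\<^esub> k) \<cdot>\<^bsub>\<Psi>\<^esub> \<mu>1 k) = \<theta>"
        using u'(3) by (simp_all add: u'e he)
      \<comment> \<open>The base of the competitor is identified before its components, whose
        codomains depend on it.\<close>
      have \<kappa>1: "\<kappa>1 = \<kappa>"
        using \<nu>1 \<mu>1 by (intro \<kappa>_unique[OF _ e1 _ e3 e5]) (auto simp: is_wreath_arr_def)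
      \<comment> \<open>As \<open>p\<close> is monic, the fiber map is forced as well, which places
        \<open>\<mu>1 k\<close> in the hom-set that \<open>?lift\<close> requires of
        \<open>m\<close>.\<close>
      have u1: "u1 = u"
        by (rule P.fiber_mono[OF \<gamma>(3), of _ K])
          (use \<mu>1 u e3 \<kappa>1 in \<open>auto simp: is_wreath_arr_def Hom_def F_def\<close>)
      have n1: "\<nu>1 (q0 \<cdot>\<^bsub>\<Phi>\<^esub> k) = n k" if k: "k \<in> Points \<Phi> K" for k
      proof (rule n_unique[OF k, of _ "\<mu>1 k"], intro conjI)
        show "\<nu>1 (q0 \<cdot>\<^bsub>\<Phi>\<^esub> k) \<in> Hom \<Psi> (N (q0 \<cdot>\<^bsub>\<Phi>\<^esub> k)) (Dom \<Psi> (\<gamma>' (h0 \<cdot>\<^bsub>\<Phi>\<^esub> k)))"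
          using is_wreath_arr_point(1)[OF \<nu>1 qk(1)[OF k]] over(1)[OF k] \<kappa>1 by simp
        show "\<gamma>' (h0 \<cdot>\<^bsub>\<Phi>\<^esub> k) \<cdot>\<^bsub>\<Psi>\<^esub> \<nu>1 (q0 \<cdot>\<^bsub>\<Phi>\<^esub> k) = \<omega> (q0 \<cdot>\<^bsub>\<Phi>\<^esub> k)"
          using fun_cong[OF e2, of "q0 \<cdot>\<^bsub>\<Phi>\<^esub> k"] over(2)[OF k] qk(1)[OF k] \<kappa>1 by simp
        show "\<mu>1 k \<in> Hom \<Psi> (Q k) (Dom \<Psi> (p' (h0 \<cdot>\<^bsub>\<Phi>\<^esub> k)))"
          using is_wreath_arr_point(1)[OF \<mu>1 k] over(4)[OF k] u1 by simp
        show "p' (h0 \<cdot>\<^bsub>\<Phi>\<^esub> k) \<cdot>\<^bsub>\<Psi>\<^esub> \<mu>1 k = \<nu>1 (q0 \<cdot>\<^bsub>\<Phi>\<^esub> k) \<cdot>\<^bsub>\<Psi>\<^esub> \<rho> k"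
          using fun_cong[OF e4, of k] over(3)[OF k] k u1 by simp
        show "e' (h0 \<cdot>\<^bsub>\<Phi>\<^esub> k) \<cdot>\<^bsub>\<Psi>\<^esub> \<mu>1 k = \<theta> k"
          using fun_cong[OF e6, of k] over(5)[OF k] k u1 by simp
      qed
      have "\<nu>1 j = \<nu> j" if j: "j \<in> Points \<Phi> J" for j
      proof (cases "\<eta> \<cdot>\<^bsub>\<Phi>\<^esub> j = t")
        case True
        then show ?thesis using n1[OF c(1)[OF j True]] c(2)[OF j True] j by (simp add: \<nu>_def)
      next
        case False
        then show ?thesis
          using is_wreath_arr_point(3-5)[OF \<nu>1 j] \<kappa>1 off(1)[OF j False] j Q.bang_unique[of "\<nu>1 j" "N j"]
          by (simp add: \<nu>_def)
      qed
      then have "\<nu>1 = \<nu>"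
        using is_wreath_arrD(6)[OF \<nu>] is_wreath_arrD(6)[OF \<nu>1] by (auto intro: extensionalityI)
      then show "k' = ?k" using k'e \<kappa>1 by simp
    qed
  qed
  then have "cofree_over W ?T ?t (I, M) ((D, R), (\<gamma>, g), ?T) ((F, L), (p, r), (D, R))
      ((F, L), (e, \<epsilon>), (I, M))"
    using g fib \<epsilon> by (simp add: cofree_over_def Arr_wreath Hom_wreath)
  then show ?thesis by blast
qed

end

theorem proposition4p10:
  fixes \<Phi> :: "('o, 'm) opcat" and \<Psi> :: "('p, 'n) opcat"
  assumes "perfect_operator_category \<Phi>"
    and "perfect_operator_category \<Psi>"
  shows "perfect_operator_category (\<Psi> \<wr> \<Phi>)"
proof -
  interpret operator_category_pair \<Phi> \<Psi>
    using assms by (simp add: operator_category_pair_def perfect_operator_category_def)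
  obtain T t where T: "point_classifier \<Phi> T t"
    and cof: "\<And>I. I \<in> Obj \<Phi> \<Longrightarrow> \<exists>\<gamma> p e. cofree_over \<Phi> T t I \<gamma> p e"
    using assms(1) unfolding perfect_operator_category_iff by blast
  obtain T' t' where T': "point_classifier \<Psi> T' t'"
    and cof': "\<And>I. I \<in> Obj \<Psi> \<Longrightarrow> \<exists>\<gamma> p e. cofree_over \<Psi> T' t' I \<gamma> p e"
    using assms(2) unfolding perfect_operator_category_iff by blast
  have t: "t \<in> Points \<Phi> T" "t' \<in> Points \<Psi> T'"
    using T T' by (auto simp: P.point_classifier_iff Q.point_classifier_iff)
  define TM where "TM = (\<lambda>s \<in> Points \<Phi> T. if s = t then T' else One \<Psi>)"
  have "\<exists>\<gamma> p e. cofree_over W (T, TM) (wreath_point T TM t t') (I, M) \<gamma> p e"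
    if IM: "(I, M) \<in> wreath_obj \<Psi> \<Phi>" for I M
  proof -
    obtain \<gamma> p e where 1: "cofree_over \<Phi> T t I \<gamma> p e"
      using cof[of I] IM by (auto simp: Obj_wreath)
    have "\<exists>\<gamma> p e. cofree_over \<Psi> T' t' (M i) \<gamma> p e" if "i \<in> Points \<Phi> I" for i
      using cof'[of "M i"] IM that by (auto simp: Obj_wreath)
    \<comment> \<open>Choice over the points of \<open>I\<close>: each \<open>M i\<close> receives
      its own cofree data in \<Psi>.\<close>
    then obtain \<gamma>' p' e' where
        "\<And>i. i \<in> Points \<Phi> I \<Longrightarrow> cofree_over \<Psi> T' t' (M i) (\<gamma>' i) (p' i) (e' i)"
      by metis
    from cofree_over_wreath[OF t IM 1 this] show ?thesis by (simp add: TM_def)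
  qed
  then show ?thesis
    using point_classifier_wreath[OF T T'] W.operator_category_axioms
    unfolding perfect_operator_category_iff TM_def by (metis surj_pair wreath_simps(1))
qed

end
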